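(* Let $f:[0,1]\to[0,1]$ be an $S$-unimodal map which is only finitely renormalizable and whose critical point $c$ is recurrent and not periodic. Then there exist $\delta>0$ and a sequence of nice points $y_n\in\mathcal N$ such that for every $n$ the interval $V_{y_n}$ contains a $\delta$-scaled neighborhood of $U_{y_n}$ (i.e. $(U_{y_n},V_{y_n})$ is a $\delta$-transfer range), and $|V_{y_n}|\to0$.
   Context: $f$ is $S$-unimodal: a smooth ($C^3$) map of $[0,1]$ with $f(0)=f(1)=0$, unique turning point $c$, negative Schwarzian derivative away from $c$, and non-flat critical point. For $y\in[0,1]$, $\tau(y)$ is the point with $f(\tau(y))=f(y)$, $\tau(y)\ne y$ (and $\tau(c)=c$). For $x\ne c$, $V_x$ is the open interval between $x$ and $\tau(x)$; $x$ is nice if $f^n(x)\notin V_x$ for all $n\ge0$, and $\mathcal N$ is the set of nice points. The first return map $R_x$ of $V_x$ is $R_x(y)=f^{k}(y)$ for $y\in V_x$, where $k\ge1$ is minimal with $f^k(y)\in V_x$ (defined where such $k$ exists); $U_x$ is the component of the domain of $R_x$ containing $c$. An interval $V$ contains a $\delta$-scaled neighborhood of an interval $U\subset V$ if both components of $V\setminus U$ have length at least $\delta|U|$. A $\delta$-transfer range is a pair $(U_x,V_x)$, $x\in\mathcal N$, with $V_x$ containing a $\delta$-scaled neighborhood of $U_x$. *)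

theory Defs
  imports "HOL-Analysis.Analysis"
begin

definition C3_derivs :: "real set \<Rightarrow> (real \<Rightarrow> real) \<Rightarrow> (real \<Rightarrow> real) \<Rightarrow> (real \<Rightarrow> real) \<Rightarrow> (real \<Rightarrow> real) \<Rightarrow> bool" where
  "C3_derivs S g g1 g2 g3 \<longleftrightarrow>
     (\<forall>x\<in>S. (g has_real_derivative g1 x) (at x within S)
           \<and> (g1 has_real_derivative g2 x) (at x within S)
           \<and> (g2 has_real_derivative g3 x) (at x within S))
     \<and> continuous_on S g3"

text \<open>S-unimodal map with turning point c: C^3 on [0,1], maps [0,1] into [0,1],
  f(0)=f(1)=0, unique turning point c (strictly increasing on [0,c], strictly
  decreasing on [c,1], f' nonzero away from c), negative Schwarzian away from c,
  and non-flat critical point: near c, f(x) = f(c) - |phi(x)|^l with l>1 and phi a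
  local C^3 diffeomorphism with phi(c)=0.\<close>
definition S_unimodal :: "(real \<Rightarrow> real) \<Rightarrow> real \<Rightarrow> bool" where
  "S_unimodal f c \<longleftrightarrow>
     f ` {0..1} \<subseteq> {0..1} \<and> f 0 = 0 \<and> f 1 = 0 \<and> 0 < c \<and> c < 1 \<and>
     (\<forall>x y. 0 \<le> x \<and> x < y \<and> y \<le> c \<longrightarrow> f x < f y) \<and>
     (\<forall>x y. c \<le> x \<and> x < y \<and> y \<le> 1 \<longrightarrow> f y < f x) \<and>
     (\<exists>f1 f2 f3. C3_derivs {0..1} f f1 f2 f3 \<and> f1 c = 0 \<and>
        (\<forall>x\<in>{0..1} - {c}. f1 x \<noteq> 0 \<and>
            f3 x / f1 x - 3 / 2 * (f2 x / f1 x)\<^sup>2 < 0)) \<and>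
     (\<exists>l::real. l > 1 \<and> (\<exists>e>0. 0 < c - e \<and> c + e < 1 \<and>
        (\<exists>\<phi> g1 g2 g3. C3_derivs {c-e..c+e} \<phi> g1 g2 g3 \<and>
            (\<forall>x\<in>{c-e..c+e}. g1 x \<noteq> 0) \<and> \<phi> c = 0 \<and>
            (\<forall>x\<in>{c-e..c+e}. f x = f c - \<bar>\<phi> x\<bar> powr l))))"

definition renormalizable_period :: "(real \<Rightarrow> real) \<Rightarrow> real \<Rightarrow> nat \<Rightarrow> bool" where
  "renormalizable_period f c n \<longleftrightarrow> n \<ge> 2 \<and>
     (\<exists>a b. 0 \<le> a \<and> a < b \<and> b \<le> 1 \<and> c \<in> {a..b} \<and>
        (f ^^ n) ` {a..b} \<subseteq> {a..b} \<and>
        (\<forall>i j. i < j \<and> j < n \<longrightarrow>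
           interior ((f ^^ i) ` {a..b}) \<inter> interior ((f ^^ j) ` {a..b}) = {}))"

definition finitely_renormalizable :: "(real \<Rightarrow> real) \<Rightarrow> real \<Rightarrow> bool" where
  "finitely_renormalizable f c \<longleftrightarrow> finite {n. renormalizable_period f c n}"

definition recurrent_pt :: "(real \<Rightarrow> real) \<Rightarrow> real \<Rightarrow> bool" where
  "recurrent_pt f x \<longleftrightarrow> (\<forall>e>0. \<exists>n\<ge>1. \<bar>(f ^^ n) x - x\<bar> < e)"

definition periodic_pt :: "(real \<Rightarrow> real) \<Rightarrow> real \<Rightarrow> bool" where
  "periodic_pt f x \<longleftrightarrow> (\<exists>n\<ge>1. (f ^^ n) x = x)"

definition tau :: "(real \<Rightarrow> real) \<Rightarrow> real \<Rightarrow> real \<Rightarrow> real" where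
  "tau f c y = (if y = c then c else (THE z. z \<in> {0..1} \<and> z \<noteq> y \<and> f z = f y))"

definition Vint :: "(real \<Rightarrow> real) \<Rightarrow> real \<Rightarrow> real \<Rightarrow> real set" where
  "Vint f c x = {min x (tau f c x) <..< max x (tau f c x)}"

definition nice_points :: "(real \<Rightarrow> real) \<Rightarrow> real \<Rightarrow> real set" where
  "nice_points f c = {x \<in> {0..1}. x \<noteq> c \<and> (\<forall>n. (f ^^ n) x \<notin> Vint f c x)}"

definition return_domain :: "(real \<Rightarrow> real) \<Rightarrow> real \<Rightarrow> real \<Rightarrow> real set" where
  "return_domain f c x = {y \<in> Vint f c x. \<exists>k\<ge>1. (f ^^ k) y \<in> Vint f c x}"

definition Uint :: "(real \<Rightarrow> real) \<Rightarrow> real \<Rightarrow> real \<Rightarrow> real set" where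
  "Uint f c x = connected_component_set (return_domain f c x) c"

definition ilen :: "real set \<Rightarrow> real" where
  "ilen I = Sup I - Inf I"

definition scaled_nbhd :: "real \<Rightarrow> real set \<Rightarrow> real set \<Rightarrow> bool" where
  "scaled_nbhd \<delta> U V \<longleftrightarrow> U \<noteq> {} \<and> U \<subseteq> V \<and> bounded V \<and>
     Inf U - Inf V \<ge> \<delta> * ilen U \<and> Sup V - Sup U \<ge> \<delta> * ilen U"

definition transfer_range :: "(real \<Rightarrow> real) \<Rightarrow> real \<Rightarrow> real \<Rightarrow> real \<Rightarrow> bool" where
  "transfer_range f c \<delta> x \<longleftrightarrow> x \<in> nice_points f c \<and> scaled_nbhd \<delta> (Uint f c x) (Vint f c x)"

end

(* Write c_n for the n-th iterate of the critical point. Start from a small nice interval A_0 and let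
   q_n be the first return time of c to A_n. The first return map at A_n is iterated through central
   returns; A_(n+1) is the first interval of the resulting nest that misses c_(q_n). It exists because
   f has no renormalization of period q_n. The first entry map of the critical value to A_(n+1) then
   extends to a diffeomorphism onto all of A_n. The gaps between A_(n-1) and A_n, measured in a
   coordinate in which tau is the reflection, are positive and sum to a finite value, so infinitely often
   the gap (A_n, A_(n+1)) is at most the gap (A_(n-1), A_n). For such n let Z be the central return
   domain of A_(n+1): f^(q_n) maps Z into the small gap between A_n and A_(n+1), and it extends
   over A_(n-1). Negative Schwarzian derivative (expansion of cross-ratios) therefore gives definite
   space around Z inside A_n. Either that space is already present inside A_(n+1), or A_(n+1) has
   definite space inside A_n, and a second use of cross-ratios, now for the return map Z -> A_(n+1)
   extended over A_n, gives definite space around Z inside A_(n+1). *)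

theory Submission
  imports Defs
begin

section \<open>Negative Schwarzian derivative and cross-ratios\<close>

text \<open>The obstacle is twofold: \<open>f ^^ q\<close> folds at \<open>c\<close>, and nothing
  bounds in advance the ratio of consecutive gaps of the nest. The fold is avoided by estimating
  \<open>f ^^ (q - 1)\<close> at the critical value, where the branch is monotone; the last step
  back through \<open>f\<close> costs only a root of order \<open>l\<close>, which the coordinate
  \<open>\<alpha>\<close> absorbs. As for the gaps, the image of Z lies on one side of
  \<open>c\<close>. Its far distance to the boundary of A_(n-1) and the total length of A_(n-1) are
  comparable and cancel, so only the ratio of the image to the adjacent gap (A_(n-1), A_n) is left.
  One inequality between two gaps is therefore enough, and every constant depends on
  \<open>K\<close> and \<open>l\<close> alone, not on n. Finite renormalizability enters through the
  start: A_0 is taken so small that its return time exceeds every renormalization period. The q_n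
  strictly increase, so none of them is a period and the central returns always stop. Arbitrarily
  small nice intervals exist because the critical orbit is recurrent and \<open>c\<close> is not
  periodic.\<close>

definition cross_ratio :: "real \<Rightarrow> real \<Rightarrow> real \<Rightarrow> real \<Rightarrow> real" where
  "cross_ratio w p r z = (r - p) * (z - w) / ((r - w) * (z - p))"

lemma cross_ratio_rev: "cross_ratio z r p w = cross_ratio w p r z"
proof -
  have "(p - r) * (w - z) = (r - p) * (z - w)" "(p - z) * (w - r) = (r - w) * (z - p)"
    by (simp_all add: algebra_simps)
  then show ?thesis by (simp add: cross_ratio_def)
qed

lemma cross_ratio_uminus: "cross_ratio (- w) (- p) (- r) (- z) = cross_ratio w p r z"
  using cross_ratio_rev[of w p r z] unfolding cross_ratio_def
  by (simp add: algebra_simps)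

text \<open>The second derivative of this power is -1/2 times the power itself times the Schwarzian
  derivative of the map with derivative \<open>g1\<close>.\<close>

lemma inv_sqrt_deriv_convex:
  fixes g1 g2 g3 :: "real \<Rightarrow> real"
  assumes d2: "\<And>x. x \<in> {a<..<b} \<Longrightarrow> (g1 has_real_derivative g2 x) (at x)"
    and d3: "\<And>x. x \<in> {a<..<b} \<Longrightarrow> (g2 has_real_derivative g3 x) (at x)"
    and pos: "\<And>x. x \<in> {a<..<b} \<Longrightarrow> g1 x > 0"
    and S: "\<And>x. x \<in> {a<..<b} \<Longrightarrow> g3 x / g1 x - 3 / 2 * (g2 x / g1 x)\<^sup>2 \<le> 0"
  shows "convex_on {a<..<b} (\<lambda>x. g1 x powr (-1/2))"
proof (rule f''_ge0_imp_convex)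
  show "convex {a<..<b}" by simp
next
  fix x assume x: "x \<in> {a<..<b}"
  show "((\<lambda>x. g1 x powr (-1/2)) has_real_derivative (-1/2) * g1 x powr (-3/2) * g2 x) (at x)"
    using pos[OF x] d2[OF x] by (auto intro!: derivative_eq_intros)
next
  fix x assume x: "x \<in> {a<..<b}"
  show "((\<lambda>x. (-1/2) * g1 x powr (-3/2) * g2 x) has_real_derivative
      (3/4) * g1 x powr (-5/2) * (g2 x)\<^sup>2 - (1/2) * g1 x powr (-3/2) * g3 x) (at x)"
    using pos[OF x] d2[OF x] d3[OF x]
    by (auto intro!: derivative_eq_intros simp: power2_eq_square field_simps)
next
  fix x assume x: "x \<in> {a<..<b}"
  have p: "g1 x > 0" using pos[OF x] .
  have e1: "g1 x powr (-5/2) = g1 x powr (-1/2) / (g1 x)\<^sup>2"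
    using powr_diff[of "g1 x" "-1/2" 2] p by simp
  have e2: "g1 x powr (-3/2) = g1 x powr (-1/2) / g1 x"
    using powr_diff[of "g1 x" "-1/2" 1] p by simp
  have "(3/4) * g1 x powr (-5/2) * (g2 x)\<^sup>2 - (1/2) * g1 x powr (-3/2) * g3 x
     = (-1/2) * g1 x powr (-1/2) * (g3 x / g1 x - 3 / 2 * (g2 x / g1 x)\<^sup>2)"
    unfolding e1 e2 by (simp add: power_divide algebra_simps)
  also have "\<dots> \<ge> 0" using S[OF x] p by (simp add: mult_nonneg_nonpos)
  finally show "0 \<le> (3/4) * g1 x powr (-5/2) * (g2 x)\<^sup>2 - (1/2) * g1 x powr (-3/2) * g3 x" .
qed

text \<open>Convexity keeps the inverse square root of \<open>g1\<close> below its chord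
  \<open>l\<close> over [x, y], so \<open>g1\<close> is at least the inverse square of
  \<open>l\<close>; integrating this from \<open>x\<close> to \<open>y\<close> gives the bound.
  Moebius maps give equality.\<close>

lemma deriv_product_le_difference_quotient:
  fixes g g1 g2 g3 :: "real \<Rightarrow> real"
  assumes d1: "\<And>x. x \<in> {a<..<b} \<Longrightarrow> (g has_real_derivative g1 x) (at x)"
    and d2: "\<And>x. x \<in> {a<..<b} \<Longrightarrow> (g1 has_real_derivative g2 x) (at x)"
    and d3: "\<And>x. x \<in> {a<..<b} \<Longrightarrow> (g2 has_real_derivative g3 x) (at x)"
    and pos: "\<And>x. x \<in> {a<..<b} \<Longrightarrow> g1 x > 0"
    and S: "\<And>x. x \<in> {a<..<b} \<Longrightarrow> g3 x / g1 x - 3 / 2 * (g2 x / g1 x)\<^sup>2 \<le> 0"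
    and xy: "a < x" "x < y" "y < b"
  shows "g1 x * g1 y * (y - x)\<^sup>2 \<le> (g y - g x)\<^sup>2"
proof -
  define v where "v t = g1 t powr (-1/2)" for t
  define l where "l t = v x + (t - x) * ((v y - v x) / (y - x))" for t
  \<comment> \<open>The antiderivative of the inverse square of \<open>l\<close> that vanishes at
    \<open>x\<close>; it is a Moebius map because \<open>l\<close> is affine.\<close>
  define A where "A t = (t - x) / (v x * l t)" for t
  have ab: "t \<in> {a<..<b}" if "x \<le> t" "t \<le> y" for t using that xy by auto
  have vpos: "v t > 0" if "x \<le> t" "t \<le> y" for t using pos[OF ab[OF that]] by (simp add: v_def)
  have v2: "1 / (v t)\<^sup>2 = g1 t" if "x \<le> t" "t \<le> y" for t
  proof -
    have p: "g1 t > 0" using pos[OF ab[OF that]] .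
    have "(v t)\<^sup>2 = g1 t powr (-1)"
      unfolding v_def power2_eq_square by (simp add: powr_add[symmetric] p)
    then show ?thesis using p by (simp add: powr_minus_divide)
  qed
  have cv: "convex_on {a<..<b} v" unfolding v_def
    by (rule inv_sqrt_deriv_convex[OF d2 d3 pos S]) auto
  have vl: "v t \<le> l t" if t: "x \<le> t" "t \<le> y" for t
  proof -
    have "convex_on {x..y} v"
      by (rule convex_on_subset[OF cv]) (use xy in auto)
    from convex_onD_Icc'[OF this, of t] show ?thesis using t unfolding l_def by (simp add: algebra_simps)
  qed
  have lpos: "l t > 0" if "x \<le> t" "t \<le> y" for t using vl[OF that] vpos[OF that] by linarith
  have dA: "(A has_real_derivative 1 / (l t)\<^sup>2) (at t)" if t: "x \<le> t" "t \<le> y" for t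
  proof -
    define m where "m = (v y - v x) / (y - x)"
    have L: "l s = v x + (s - x) * m" for s by (simp add: l_def m_def)
    have lt: "v x + (t - x) * m > 0" using lpos[OF t] L by simp
    have vx: "v x > 0" using vpos[of x] xy by simp
    have "((\<lambda>s. (s - x) / (v x * (v x + (s - x) * m))) has_real_derivative
       (v x * (v x + (t - x) * m) - (t - x) * (v x * m)) / (v x * (v x + (t - x) * m))\<^sup>2) (at t)"
      using lt vx by (auto intro!: derivative_eq_intros simp: power2_eq_square)
    moreover have "(v x * (v x + (t - x) * m) - (t - x) * (v x * m)) / (v x * (v x + (t - x) * m))\<^sup>2
        = 1 / (v x + (t - x) * m)\<^sup>2"
    proof -
      have e: "v x * (v x + (t - x) * m) - (t - x) * (v x * m) = (v x)\<^sup>2"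
        by (simp add: power2_eq_square algebra_simps)
      show ?thesis unfolding e power_mult_distrib using vx by simp
    qed
    ultimately show ?thesis unfolding A_def L by simp
  qed
  have "g x - A x \<le> g y - A y"
  proof (rule DERIV_nonneg_imp_nondecreasing[OF less_imp_le[OF xy(2)]])
    fix t assume t: "x \<le> t" "t \<le> y"
    have "((\<lambda>t. g t - A t) has_real_derivative g1 t - 1 / (l t)\<^sup>2) (at t)"
      by (intro derivative_intros d1 ab dA t)
    moreover have "1 / (l t)\<^sup>2 \<le> 1 / (v t)\<^sup>2"
      using vl[OF t] vpos[OF t] by (intro divide_left_mono power_mono mult_pos_pos) (auto simp: lpos[OF t])
    ultimately show "\<exists>d. ((\<lambda>t. g t - A t) has_real_derivative d) (at t) \<and> 0 \<le> d"
      using v2[OF t] by (intro exI[of _ "g1 t - 1 / (l t)\<^sup>2"]) auto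
  qed
  moreover have "A x = 0" by (simp add: A_def)
  moreover have ly: "l y = v y" using xy by (simp add: l_def)
  ultimately have le: "(y - x) / (v x * v y) \<le> g y - g x" by (simp add: A_def ly)
  have "0 \<le> (y - x) / (v x * v y)" using xy vpos[of x] vpos[of y] by simp
  then have "((y - x) / (v x * v y))\<^sup>2 \<le> (g y - g x)\<^sup>2" using le by (rule power_mono[rotated])
  moreover have "((y - x) / (v x * v y))\<^sup>2 = g1 x * g1 y * (y - x)\<^sup>2"
    using xy by (simp add: v2[of x, symmetric] v2[of y, symmetric] power_divide power_mult_distrib)
  ultimately show ?thesis by simp
qed

text \<open>By the preceding lemma the mixed second derivative of ln (g y - g x) is at most that of
  ln (y - x). Integrating over x in [w, p] and y in [r, z] gives the logarithm of the claim.
  Derivatives are required only in the open interval, so an endpoint may be critical.\<close>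

lemma cross_ratio_expand_pos:
  fixes g g1 g2 g3 :: "real \<Rightarrow> real"
  assumes cont: "continuous_on {w..z} g"
    and d1: "\<And>x. x \<in> {w<..<z} \<Longrightarrow> (g has_real_derivative g1 x) (at x)"
    and d2: "\<And>x. x \<in> {w<..<z} \<Longrightarrow> (g1 has_real_derivative g2 x) (at x)"
    and d3: "\<And>x. x \<in> {w<..<z} \<Longrightarrow> (g2 has_real_derivative g3 x) (at x)"
    and pos: "\<And>x. x \<in> {w<..<z} \<Longrightarrow> g1 x > 0"
    and S: "\<And>x. x \<in> {w<..<z} \<Longrightarrow> g3 x / g1 x - 3 / 2 * (g2 x / g1 x)\<^sup>2 \<le> 0"
    and o: "w < p" "p < r" "r < z"
  shows "cross_ratio w p r z \<le> cross_ratio (g w) (g p) (g r) (g z)"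
proof -
  have mono: "g x < g y" if "w \<le> x" "x < y" "y \<le> z" for x y
  proof (rule DERIV_pos_imp_increasing_open[OF that(2)])
    show "continuous_on {x..y} g" by (rule continuous_on_subset[OF cont]) (use that in auto)
    fix t assume "x < t" "t < y"
    then have "t \<in> {w<..<z}" using that by auto
    then show "\<exists>d. DERIV g t :> d \<and> 0 < d" using d1 pos by blast
  qed
  have cont': "continuous_on A g" if "A \<subseteq> {w..z}" for A
    using continuous_on_subset[OF cont that] .
  \<comment> \<open>The integration in the first variable, from \<open>w\<close> to
    \<open>p\<close>.\<close>
  have step: "g1 y / (g y - g p) - 1 / (y - p) \<le> g1 y / (g y - g w) - 1 / (y - w)"
    if y: "r < y" "y < z" for y
  proof (rule DERIV_nonpos_imp_decreasing_open[where f="\<lambda>x. g1 y / (g y - g x) - 1 / (y - x)" and a=w and b=p])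
    show "w \<le> p" using o by simp
    show "continuous_on {w..p} (\<lambda>x. g1 y / (g y - g x) - 1 / (y - x))"
    proof (intro continuous_intros cont')
      show "{w..p} \<subseteq> {w..z}" using o by auto
      show "\<forall>x\<in>{w..p}. g y - g x \<noteq> 0"
      proof
        fix x assume "x \<in> {w..p}"
        then have "g x < g y" using mono[of x y] o y by auto
        then show "g y - g x \<noteq> 0" by simp
      qed
      show "\<forall>x\<in>{w..p}. y - x \<noteq> 0" using o y by auto
    qed
    fix x assume x: "w < x" "x < p"
    have gxy: "g x < g y" using mono[of x y] o y x by auto
    have xin: "x \<in> {w<..<z}" using x o by auto
    have "((\<lambda>x. g1 y / (g y - g x) - 1 / (y - x)) has_real_derivative
        g1 x * g1 y / (g y - g x)\<^sup>2 - 1 / (y - x)\<^sup>2) (at x)"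
      using gxy x y o d1[OF xin] by (auto intro!: derivative_eq_intros simp: power2_eq_square)
    moreover have "g1 x * g1 y / (g y - g x)\<^sup>2 - 1 / (y - x)\<^sup>2 \<le> 0"
    proof -
      have "g1 x * g1 y * (y - x)\<^sup>2 \<le> (g y - g x)\<^sup>2"
        by (rule deriv_product_le_difference_quotient[OF d1 d2 d3 pos S, of w z]) (use x y o in auto)
      moreover have "(y - x)\<^sup>2 > 0" "(g y - g x)\<^sup>2 > 0" using x y o gxy by auto
      ultimately show ?thesis by (simp add: field_simps)
    qed
    ultimately show "\<exists>d. ((\<lambda>x. g1 y / (g y - g x) - 1 / (y - x)) has_real_derivative d) (at x) \<and> d \<le> 0"
      by blast
  qed
  \<comment> \<open>The integration in the second variable: the derivative of \<open>F\<close> is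
    the difference of the two sides of \<open>step\<close>.\<close>
  define F where "F y = ln (g y - g p) - ln (y - p) - ln (g y - g w) + ln (y - w)" for y
  have "F z \<le> F r"
  proof (rule DERIV_nonpos_imp_decreasing_open[where f=F])
    show "r \<le> z" using o by simp
    have "\<And>y. y \<in> {r..z} \<Longrightarrow> g p < g y \<and> g w < g y" using mono o by auto
    then show "continuous_on {r..z} F" unfolding F_def
      by (intro continuous_intros cont') (use o in force)+
    fix y assume y: "r < y" "y < z"
    have gy: "g p < g y" "g w < g y" using mono o y by auto
    have "(F has_real_derivative g1 y / (g y - g p) - 1 / (y - p) - g1 y / (g y - g w) + 1 / (y - w)) (at y)"
      unfolding F_def using gy y o d1[of y] by (auto intro!: derivative_eq_intros)
    then show "\<exists>d. (F has_real_derivative d) (at y) \<and> d \<le> 0"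
      using step[OF y] by (intro exI[of _ "g1 y / (g y - g p) - 1 / (y - p) - g1 y / (g y - g w) + 1 / (y - w)"]) auto
  qed
  moreover have F: "F y = ln ((g y - g p) * (y - w) / ((g y - g w) * (y - p)))" if "r \<le> y" "y \<le> z" for y
  proof -
    have "g p < g y" "g w < g y" using mono o that by auto
    then show ?thesis unfolding F_def using that o by (simp add: ln_mult ln_div)
  qed
  have gg: "g p < g r" "g w < g r" "g p < g z" "g w < g z" using mono o by auto
  have posq: "(g y - g p) * (y - w) / ((g y - g w) * (y - p)) > 0" if "r \<le> y" "y \<le> z" for y
  proof -
    have "g p < g y" "g w < g y" using mono o that by auto
    then show ?thesis using that o by simp
  qed
  ultimately have "(g z - g p) * (z - w) / ((g z - g w) * (z - p)) \<le> (g r - g p) * (r - w) / ((g r - g w) * (r - p))"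
    using F[of z] F[of r] posq[of z] posq[of r] o by simp
  then have le: "B * z_w / (A * z_p) \<le> D * r_w / (C * r_p)"
    if "A = g z - g w" "B = g z - g p" "C = g r - g w" "D = g r - g p"
      "z_w = z - w" "z_p = z - p" "r_w = r - w" "r_p = r - p" for A B C D z_w z_p r_w r_p
    using that by simp
  \<comment> \<open>A rearrangement stated for abstract positive reals, so that simplification does
    not multiply out the differences.\<close>
  have "r_p * z_w / (r_w * z_p) \<le> D * A / (C * B)"
    if "B * z_w / (A * z_p) \<le> D * r_w / (C * r_p)"
      "A > 0" "B > 0" "C > 0" "D > 0" "z_w > 0" "z_p > 0" "r_w > 0" "r_p > 0"
    for A B C D z_w z_p r_w r_p :: real
    using that by (simp add: field_simps)
  from this[OF le[OF refl refl refl refl refl refl refl refl]] show ?thesis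
    unfolding cross_ratio_def using gg o by simp
qed

section \<open>Symmetric intervals and monotone branches\<close>

locale unimodal =
  fixes f :: "real \<Rightarrow> real" and c :: real
  assumes S: "S_unimodal f c"
begin

abbreviation "\<tau> \<equiv> tau f c"
abbreviation "V \<equiv> Vint f c"

lemma c01: "0 < c" "c < 1" and f0: "f 0 = 0" and f1: "f 1 = 0"
  and range: "\<And>x. x \<in> {0..1} \<Longrightarrow> f x \<in> {0..1}"
  and incr: "\<And>x y. 0 \<le> x \<Longrightarrow> x < y \<Longrightarrow> y \<le> c \<Longrightarrow> f x < f y"
  and decr: "\<And>x y. c \<le> x \<Longrightarrow> x < y \<Longrightarrow> y \<le> 1 \<Longrightarrow> f y < f x"
  using S unfolding S_unimodal_def by (blast | (simp add: image_subset_iff))+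

lemma cont_f: "continuous_on {0..1} f"
proof -
  obtain f1 f2 f3 where "C3_derivs {0..1} f f1 f2 f3"
    using S unfolding S_unimodal_def by blast
  then show ?thesis unfolding C3_derivs_def continuous_on_eq_continuous_within
    by (meson DERIV_continuous)
qed

lemma iter_range: "x \<in> {0..1} \<Longrightarrow> (f ^^ n) x \<in> {0..1}"
  by (induction n) (auto simp del: atLeastAtMost_iff intro: range)

lemma cont_iter: "continuous_on {0..1} (f ^^ n)"
proof (induction n)
  case (Suc n)
  have "(f ^^ n) ` {0..1} \<subseteq> {0..1}" using iter_range by blast
  with Suc show ?case
    using continuous_on_compose[OF Suc continuous_on_subset[OF cont_f]] by simp
qed (simp add: id_def)

lemma cont_iter': "A \<subseteq> {0..1} \<Longrightarrow> continuous_on A (f ^^ n)"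
  using cont_iter continuous_on_subset by blast

lemma iter_add: "(f ^^ m) ((f ^^ n) x) = (f ^^ (m + n)) x"
  by (simp add: funpow_add)

lemma iter_zero: "(f ^^ n) 0 = 0"
  by (induction n) (auto simp: f0)

lemma iter_one: "n > 0 \<Longrightarrow> (f ^^ n) 1 = 0"
  using iter_zero[of "n - 1"] funpow_swap1[of f "n - 1" 1] f1 by (cases n) auto

lemma iter_eq: "f x = f y \<Longrightarrow> n > 0 \<Longrightarrow> (f ^^ n) x = (f ^^ n) y"
  by (cases n) (auto simp: funpow_swap1)

text \<open>Strict monotonicity on each side of \<open>c\<close> leaves at most one other point of
  the same height, which turns the definite description in \<open>tau\<close> into a usable
  value.\<close>

lemma tau_unique:
  assumes "0 \<le> x" "x < c" "z \<in> {0..1}" "z \<noteq> x" "f z = f x"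
  shows "c < z \<and> \<tau> x = z"
proof -
  have gt: "c < w" if "w \<in> {0..1}" "w \<noteq> x" "f w = f x" for w
    using incr[of x w] incr[of w x] that assms by (cases w x rule: linorder_cases) force+
  have "(THE z. z \<in> {0..1} \<and> z \<noteq> x \<and> f z = f x) = z"
  proof (rule the_equality)
    fix w assume w: "w \<in> {0..1} \<and> w \<noteq> x \<and> f w = f x"
    show "w = z" using gt[of w] gt[of z] w assms decr[of w z] decr[of z w]
      by (cases w z rule: linorder_cases) auto
  qed (use assms in auto)
  then show ?thesis using gt assms by (auto simp: tau_def)
qed

lemma tau_left:
  assumes "0 \<le> x" "x < c"
  shows "c < \<tau> x" "\<tau> x \<le> 1" "f (\<tau> x) = f x"
proof -
  have "f 1 \<le> f x" using range[of x] assms c01 f1 by auto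
  moreover have "f x \<le> f c" using incr[of x c] assms by simp
  ultimately obtain z where z: "c \<le> z" "z \<le> 1" "f z = f x"
    using IVT2'[of f 1 "f x" c] c01 continuous_on_subset[OF cont_f, of "{c..1}"] by auto
  then have "c < \<tau> x \<and> \<tau> x = z" using tau_unique[of x z] assms c01 by auto
  then show "c < \<tau> x" "\<tau> x \<le> 1" "f (\<tau> x) = f x" using z by auto
qed

lemma tau_right: 
  assumes "c < z" "z \<le> 1"
  obtains x where "0 \<le> x" "x < c" "z = \<tau> x"
proof -
  have "f 0 \<le> f z" using range[of z] assms c01 f0 by auto
  moreover have fz: "f z < f c" using decr[of c z] assms by simp
  ultimately obtain x where x: "0 \<le> x" "x \<le> c" "f x = f z"
    using IVT'[of f 0 "f z" c] c01 continuous_on_subset[OF cont_f, of "{0..c}"] by auto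
  with fz have "x < c" by (cases "x = c") auto
  then show ?thesis using that[of x] tau_unique[of x z] x assms c01 by auto
qed

lemma tau_strict: "0 \<le> x \<Longrightarrow> x < y \<Longrightarrow> y < c \<Longrightarrow> \<tau> y < \<tau> x"
  using tau_left[of x] tau_left[of y] incr[of x y] decr[of "\<tau> x" "\<tau> y"]
  by (cases "\<tau> x" "\<tau> y" rule: linorder_cases) auto

lemma tau_mono: "0 \<le> x \<Longrightarrow> x \<le> y \<Longrightarrow> y < c \<Longrightarrow> \<tau> y \<le> \<tau> x"
  using tau_strict[of x y] by (cases "x = y") auto

lemma V_left: "0 \<le> x \<Longrightarrow> x < c \<Longrightarrow> V x = {x<..<\<tau> x}"
  using tau_left(1)[of x] by (simp add: Vint_def min_def max_def)

lemma c_in_V: "0 \<le> x \<Longrightarrow> x < c \<Longrightarrow> c \<in> V x"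
  using tau_left(1)[of x] V_left[of x] by simp

lemma V_mono: "0 \<le> x \<Longrightarrow> x \<le> y \<Longrightarrow> y < c \<Longrightarrow> V y \<subseteq> V x"
  using V_left[of x] V_left[of y] tau_mono[of x y] by auto

text \<open>A point and its mirror image span the same interval, so nice intervals can be named by
  their left endpoints; nesting then becomes the order of the reals.\<close>

definition lnice :: "real \<Rightarrow> bool" where
  "lnice x \<longleftrightarrow> 0 \<le> x \<and> x < c \<and> (\<forall>n. (f ^^ n) x \<notin> V x)"

lemma lniceD: "lnice x \<Longrightarrow> 0 \<le> x" "lnice x \<Longrightarrow> x < c" "lnice x \<Longrightarrow> (f ^^ n) x \<notin> V x"
  by (auto simp: lnice_def)

lemma lnice_nice: "lnice x \<Longrightarrow> x \<in> nice_points f c"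
  using c01 by (auto simp: lnice_def nice_points_def)

text \<open>Both endpoints have the same image, so niceness of one serves both. Most later
  contradictions end here: an orbit that has touched the boundary of \<open>V x\<close> can never
  enter \<open>V x\<close> again.\<close>

lemma lnice_boundary:
  assumes "lnice x" "v \<in> {x, \<tau> x}"
  shows "(f ^^ n) v \<notin> V x"
proof (cases "n = 0 \<or> v = x")
  case True
  then show ?thesis
  proof
    assume "n = 0"
    then show ?thesis using assms V_left[of x] lniceD(1,2)[of x] by auto
  qed (use assms lniceD(3) in simp)
next
  case False
  then have "(f ^^ n) v = (f ^^ n) x" using assms iter_eq[of v x n] tau_left[of x] lniceD by auto
  then show ?thesis using assms lniceD by metis
qed

lemma boundary_outside: "0 \<le> x \<Longrightarrow> x < c \<Longrightarrow> v \<in> {x, \<tau> x} \<Longrightarrow> v \<notin> V x"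
  using V_left[of x] by auto

lemma crossing:
  fixes g :: "real \<Rightarrow> real"
  assumes "continuous_on {a..b} g" "a \<le> b" "0 \<le> x" "x < c" "(g a \<in> V x) \<noteq> (g b \<in> V x)"
  obtains v where "v \<in> {a..b}" "g v \<in> {x, \<tau> x}"
proof -
  have V: "V x = {x<..<\<tau> x}" "x < \<tau> x" using V_left[of x] tau_left[of x] assms by auto
  have cn: "connected (g ` {a..b})" by (intro connected_continuous_image assms connected_Icc)
  have ab: "g a \<in> g ` {a..b}" "g b \<in> g ` {a..b}" using assms(2) by auto
  have "\<exists>y \<in> g ` {a..b}. y \<in> {x, \<tau> x}"
    using connectedD_interval[OF cn ab] connectedD_interval[OF cn ab(2) ab(1)] assms(5) V 
    by (smt (verit, ccfv_threshold) greaterThanLessThan_iff insertCI)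
  then show ?thesis using that by auto
qed

text \<open>Only the open interval has to avoid \<open>c\<close>, so the ends of a branch may be
  precritical; with \<open>j < m\<close> the final image is still free to contain
  \<open>c\<close>.\<close>

definition mono_branch :: "nat \<Rightarrow> real \<Rightarrow> real \<Rightarrow> bool" where
  "mono_branch m a b \<longleftrightarrow> 0 \<le> a \<and> a \<le> b \<and> b \<le> 1 \<and> (\<forall>j<m. c \<notin> (f ^^ j) ` {a<..<b})"

lemma f_no_crit:
  assumes "0 \<le> a" "a \<le> b" "b \<le> 1" "c \<notin> {a<..<b}"
  shows "(\<forall>x y. a \<le> x \<and> x < y \<and> y \<le> b \<longrightarrow> f x < f y) \<or> (\<forall>x y. a \<le> x \<and> x < y \<and> y \<le> b \<longrightarrow> f y < f x)"
proof (cases "b \<le> c")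
  case True
  then show ?thesis using incr assms by auto
next
  case False
  then have "c \<le> a" using assms by auto
  then show ?thesis using decr assms by auto
qed

lemma cross_ratio_f:
  assumes o: "0 \<le> w" "w < p" "p < r" "r < z" "z \<le> 1" and nc: "c \<notin> {w<..<z}"
  shows "cross_ratio w p r z \<le> cross_ratio (f w) (f p) (f r) (f z)"
proof -
  obtain f1 f2 f3 where C3: "C3_derivs {0..1} f f1 f2 f3" and
    N: "\<And>x. x \<in> {0..1} - {c} \<Longrightarrow> f1 x \<noteq> 0 \<and> f3 x / f1 x - 3 / 2 * (f2 x / f1 x)\<^sup>2 < 0"
    using S unfolding S_unimodal_def by blast
  have at: "at x within {0..1} = at x" if "x \<in> {w<..<z}" for x
    using that o by (intro at_within_interior) (simp add: interior_atLeastAtMost_real)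
  have d: "(f has_real_derivative f1 x) (at x)" "(f1 has_real_derivative f2 x) (at x)"
     "(f2 has_real_derivative f3 x) (at x)" if "x \<in> {w<..<z}" for x
  proof -
    have "x \<in> {0..1}" using that o by auto
    then show "(f has_real_derivative f1 x) (at x)" "(f1 has_real_derivative f2 x) (at x)"
      "(f2 has_real_derivative f3 x) (at x)"
      using C3 unfolding C3_derivs_def by (metis at[OF that])+
  qed
  have ct: "continuous_on {w..z} f" using continuous_on_subset[OF cont_f] o by auto
  have N': "f1 x \<noteq> 0" "f3 x / f1 x - 3 / 2 * (f2 x / f1 x)\<^sup>2 \<le> 0" if "x \<in> {w<..<z}" for x
  proof -
    have "x \<in> {0..1} - {c}" using that nc o by auto
    from N[OF this] show "f1 x \<noteq> 0" "f3 x / f1 x - 3 / 2 * (f2 x / f1 x)\<^sup>2 \<le> 0" by auto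
  qed
  have sgn: "(\<forall>x\<in>{w<..<z}. f1 x > 0) \<or> (\<forall>x\<in>{w<..<z}. f1 x < 0)"
  proof (rule ccontr)
    assume "\<not> ?thesis"
    then obtain x y where xy: "x \<in> {w<..<z}" "y \<in> {w<..<z}" "f1 x \<le> 0" "f1 y \<ge> 0"
      by (force simp: not_less)
    have ct1: "continuous_on {w<..<z} f1"
      by (meson d(2) DERIV_isCont continuous_at_imp_continuous_on)
    have cn: "connected (f1 ` {w<..<z})" by (intro connected_continuous_image ct1 connected_Ioo)
    have "0 \<in> f1 ` {w<..<z}" using connectedD_interval[OF cn, of "f1 x" "f1 y" 0] xy by auto
    then show False using N'(1) by force
  qed
  then show ?thesis
  proof
    assume "\<forall>x\<in>{w<..<z}. f1 x > 0"
    then show ?thesis using cross_ratio_expand_pos[OF ct d _ N'(2), of p r] o by blast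
  next
    assume neg: "\<forall>x\<in>{w<..<z}. f1 x < 0"
    \<comment> \<open>On a decreasing piece \<open>- f\<close> is increasing, has the same
      Schwarzian derivative and yields the same cross-ratio.\<close>
    have "cross_ratio w p r z \<le> cross_ratio (- f w) (- f p) (- f r) (- f z)"
    proof (rule cross_ratio_expand_pos[where ?g1.0="\<lambda>x. - f1 x" and ?g2.0="\<lambda>x. - f2 x" and ?g3.0="\<lambda>x. - f3 x"])
      show "continuous_on {w..z} (\<lambda>x. - f x)" by (intro continuous_intros ct)
    qed (use d neg N' o in \<open>auto intro!: DERIV_minus\<close>)
    then show ?thesis by (simp add: cross_ratio_uminus)
  qed
qed

text \<open>The two claims share one induction: the order of the images under \<open>f ^^ m\<close>,
  together with the absence of \<open>c\<close> between them, is what allows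
  \<open>cross_ratio_f\<close> to be applied to the next iterate.\<close>

lemma mono_branch_mono:
  assumes "mono_branch m a b"
  shows "(\<forall>x y. a \<le> x \<and> x < y \<and> y \<le> b \<longrightarrow> (f ^^ m) x < (f ^^ m) y) \<or>
         (\<forall>x y. a \<le> x \<and> x < y \<and> y \<le> b \<longrightarrow> (f ^^ m) y < (f ^^ m) x)"
    and "\<And>w p r z. a \<le> w \<Longrightarrow> w < p \<Longrightarrow> p < r \<Longrightarrow> r < z \<Longrightarrow> z \<le> b \<Longrightarrow>
      cross_ratio w p r z \<le> cross_ratio ((f ^^ m) w) ((f ^^ m) p) ((f ^^ m) r) ((f ^^ m) z)"
proof -
  have "((\<forall>x y. a \<le> x \<and> x < y \<and> y \<le> b \<longrightarrow> (f ^^ m) x < (f ^^ m) y) \<or>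
         (\<forall>x y. a \<le> x \<and> x < y \<and> y \<le> b \<longrightarrow> (f ^^ m) y < (f ^^ m) x)) \<and>
     (\<forall>w p r z. a \<le> w \<and> w < p \<and> p < r \<and> r < z \<and> z \<le> b \<longrightarrow>
      cross_ratio w p r z \<le> cross_ratio ((f ^^ m) w) ((f ^^ m) p) ((f ^^ m) r) ((f ^^ m) z))"
    using assms
  proof (induction m)
    case (Suc m)
    let ?g = "f ^^ m"
    have ab: "0 \<le> a" "a \<le> b" "b \<le> 1" and nc: "c \<notin> ?g ` {a<..<b}" and mb: "mono_branch m a b"
      using Suc.prems by (auto simp: mono_branch_def)
    have ga: "?g x \<in> {0..1}" if "a \<le> x" "x \<le> b" for x using iter_range that ab by simp
    have C: "continuous_on {a..b} ?g" using cont_iter' ab by auto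
    have ncs: "c \<notin> {?g x<..<?g y} \<and> c \<notin> {?g y<..<?g x}" if "a \<le> x" "x < y" "y \<le> b" for x y
    proof -
      have cn: "connected (?g ` {x..y})"
        by (intro connected_continuous_image connected_Icc continuous_on_subset[OF C]) (use that in auto)
      have "c \<notin> ?g ` {x<..<y}" using nc that by auto
      moreover have "?g ` {x..y} \<subseteq> insert (?g x) (insert (?g y) (?g ` {x<..<y}))"
        using that by (auto simp: image_iff) (metis greaterThanLessThan_iff less_eq_real_def)
      moreover have "c \<in> ?g ` {x..y}" if "c \<in> {?g x<..<?g y} \<or> c \<in> {?g y<..<?g x}"
        using connectedD_interval[OF cn, of "?g x" "?g y" c] connectedD_interval[OF cn, of "?g y" "?g x" c]
          that \<open>x < y\<close> by (auto simp del: image_iff)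
      ultimately show ?thesis by (smt (verit) greaterThanLessThan_iff insertE subsetD)
    qed
    note IH = Suc.IH[OF mb]
    from IH have "(\<forall>x y. a \<le> x \<and> x < y \<and> y \<le> b \<longrightarrow> ?g x < ?g y) \<or>
         (\<forall>x y. a \<le> x \<and> x < y \<and> y \<le> b \<longrightarrow> ?g y < ?g x)" by blast
    then show ?case
    proof
      assume m: "\<forall>x y. a \<le> x \<and> x < y \<and> y \<le> b \<longrightarrow> ?g x < ?g y"
      have mm: "?g a \<le> ?g x \<and> ?g x \<le> ?g b" if "a \<le> x" "x \<le> b" for x 
        using m that by (metis less_eq_real_def)
      have "c \<notin> {?g a<..<?g b}" using ncs[of a b] ab by (cases "a = b") auto
      from f_no_crit[OF _ _ _ this] have "(\<forall>x y. a \<le> x \<and> x < y \<and> y \<le> b \<longrightarrow> f (?g x) < f (?g y)) \<or>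
         (\<forall>x y. a \<le> x \<and> x < y \<and> y \<le> b \<longrightarrow> f (?g y) < f (?g x))"
        using ga[of a] ga[of b] mm m ab
        by (smt (verit, best) atLeastAtMost_iff)
      moreover have "cross_ratio w p r z \<le> cross_ratio (f (?g w)) (f (?g p)) (f (?g r)) (f (?g z))"
        if "a \<le> w" "w < p" "p < r" "r < z" "z \<le> b" for w p r z
      proof -
        have "cross_ratio w p r z \<le> cross_ratio (?g w) (?g p) (?g r) (?g z)" using IH that by blast
        also have "\<dots> \<le> cross_ratio (f (?g w)) (f (?g p)) (f (?g r)) (f (?g z))"
          by (rule cross_ratio_f) (use m that ga[of w] ga[of z] ncs[of w z] in auto)
        finally show ?thesis .
      qed
      ultimately show ?case by simp
    next
      assume m: "\<forall>x y. a \<le> x \<and> x < y \<and> y \<le> b \<longrightarrow> ?g y < ?g x"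
      have mm: "?g b \<le> ?g x \<and> ?g x \<le> ?g a" if "a \<le> x" "x \<le> b" for x 
        using m that by (metis less_eq_real_def)
      have "c \<notin> {?g b<..<?g a}" using ncs[of a b] ab by (cases "a = b") auto
      from f_no_crit[OF _ _ _ this] have "(\<forall>x y. a \<le> x \<and> x < y \<and> y \<le> b \<longrightarrow> f (?g x) < f (?g y)) \<or>
         (\<forall>x y. a \<le> x \<and> x < y \<and> y \<le> b \<longrightarrow> f (?g y) < f (?g x))"
        using ga[of a] ga[of b] mm m ab
        by (smt (verit, best) atLeastAtMost_iff)
      moreover have "cross_ratio w p r z \<le> cross_ratio (f (?g w)) (f (?g p)) (f (?g r)) (f (?g z))"
        if "a \<le> w" "w < p" "p < r" "r < z" "z \<le> b" for w p r z
      proof -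
        have "cross_ratio w p r z \<le> cross_ratio (?g w) (?g p) (?g r) (?g z)" using IH that by blast
        also have "\<dots> = cross_ratio (?g z) (?g r) (?g p) (?g w)" by (rule cross_ratio_rev[symmetric])
        also have "\<dots> \<le> cross_ratio (f (?g z)) (f (?g r)) (f (?g p)) (f (?g w))"
          by (rule cross_ratio_f) (use m that ga[of w] ga[of z] ncs[of w z] in auto)
        also have "\<dots> = cross_ratio (f (?g w)) (f (?g p)) (f (?g r)) (f (?g z))" by (rule cross_ratio_rev)
        finally show ?thesis .
      qed
      ultimately show ?case by simp
    qed
  qed simp
  then show "(\<forall>x y. a \<le> x \<and> x < y \<and> y \<le> b \<longrightarrow> (f ^^ m) x < (f ^^ m) y) \<or>
         (\<forall>x y. a \<le> x \<and> x < y \<and> y \<le> b \<longrightarrow> (f ^^ m) y < (f ^^ m) x)"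
    and "\<And>w p r z. a \<le> w \<Longrightarrow> w < p \<Longrightarrow> p < r \<Longrightarrow> r < z \<Longrightarrow> z \<le> b \<Longrightarrow>
      cross_ratio w p r z \<le> cross_ratio ((f ^^ m) w) ((f ^^ m) p) ((f ^^ m) r) ((f ^^ m) z)"
    by blast+
qed

lemma mono_branch_between:
  assumes "mono_branch m a b" "a \<le> x" "x \<le> y" "y \<le> z" "z \<le> b" 
    and "(f ^^ m) x \<in> {l<..<r}" "(f ^^ m) z \<in> {l<..<r}"
  shows "(f ^^ m) y \<in> {l<..<r}"
proof (cases "x = y \<or> y = z")
  case False
  then show ?thesis using mono_branch_mono(1)[OF assms(1)] assms(2-)
    by (smt (verit, ccfv_threshold) greaterThanLessThan_iff)
qed (use assms in auto)

end

section \<open>Nice points and first returns\<close>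

context unimodal begin

definition first_return :: "nat \<Rightarrow> real \<Rightarrow> bool" where
  "first_return q x \<longleftrightarrow> 0 < q \<and> (f ^^ q) c \<in> V x \<and> (\<forall>j. 0 < j \<and> j < q \<longrightarrow> (f ^^ j) c \<notin> V x)"

text \<open>The left endpoint of the component around \<open>c\<close> of the points sent into
  \<open>V x\<close>; for the first return time \<open>q\<close> that component is
  \<open>Uint f c x\<close>, see \<open>Uint_ret_end\<close>. The left half suffices because
  positive iterates are symmetric under \<open>tau\<close>.\<close>

definition ret_end :: "nat \<Rightarrow> real \<Rightarrow> real" where
  "ret_end q x = Sup {y \<in> {x..c}. (f ^^ q) y \<notin> V x}"

lemma first_returnD: "first_return q x \<Longrightarrow> 0 < q" "first_return q x \<Longrightarrow> (f ^^ q) c \<in> V x"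
  "first_return q x \<Longrightarrow> 0 < j \<Longrightarrow> j < q \<Longrightarrow> (f ^^ j) c \<notin> V x"
  by (auto simp: first_return_def)

lemma left_representative:
  assumes "0 \<le> u" "u < c" "y \<in> V u"
  obtains y' where "u < y'" "y' \<le> c" "f y' = f y"
proof (cases "y \<le> c")
  case True
  then show ?thesis using that[of y] assms V_left by auto
next
  case False
  have y: "y < \<tau> u" "y \<le> 1" using V_left[of u] tau_left[of u] assms by auto
  then obtain x where x: "0 \<le> x" "x < c" "y = \<tau> x" using tau_right[of y] False by auto
  have "u < x" using tau_mono[of x u] x y assms by (cases "x \<le> u") auto
  then show ?thesis using that[of x] x tau_left by auto
qed

lemma ret_end:
  assumes x: "lnice x" and q: "(f ^^ q) c \<in> V x"
  shows "x \<le> ret_end q x" "ret_end q x < c" "(f ^^ q) (ret_end q x) \<in> {x, \<tau> x}"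
    and "\<And>y. ret_end q x < y \<Longrightarrow> y \<le> c \<Longrightarrow> (f ^^ q) y \<in> V x"
proof -
  let ?S = "{y \<in> {x..c}. (f ^^ q) y \<notin> V x}"
  let ?u = "ret_end q x"
  have xc: "0 \<le> x" "x < c" using x lniceD by auto
  have Vx: "V x = {x<..<\<tau> x}" using V_left xc by auto
  have ne: "x \<in> ?S" using lniceD(3)[OF x] xc by auto
  have bd: "bdd_above ?S" by (intro bdd_aboveI[of _ c]) auto
  have C: "continuous_on {x..c} (f ^^ q)" using cont_iter' xc c01 by auto
  have "?S = {x..c} \<inter> (f ^^ q) -` (- V x)" by auto
  moreover have "closed ({x..c} \<inter> (f ^^ q) -` (- V x))"
    by (rule continuous_closed_preimage[OF C]) (auto simp: Vx closed_def)
  ultimately have "closed ?S" by simp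
  then have uS: "?u \<in> ?S" using closed_contains_Sup[of ?S] ne bd unfolding ret_end_def by blast
  then show "x \<le> ?u" by auto
  have "?u \<noteq> c" using uS q by auto
  then show uc: "?u < c" using uS by auto
  show above: "(f ^^ q) y \<in> V x" if y: "?u < y" "y \<le> c" for y
  proof (rule ccontr)
    assume "(f ^^ q) y \<notin> V x"
    then have "y \<in> ?S" using y uS by auto
    then have "y \<le> ?u" unfolding ret_end_def using bd by (intro cSup_upper) auto
    then show False using y by auto
  qed
  have "((f ^^ q) ?u \<in> V x) \<noteq> ((f ^^ q) c \<in> V x)" using uS q by auto
  then obtain v where v: "v \<in> {?u..c}" "(f ^^ q) v \<in> {x, \<tau> x}"
    using crossing[of ?u c "f ^^ q" x] continuous_on_subset[OF C] uS uc xc by (auto simp del: insert_iff)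
  have "v = ?u"
  proof (rule ccontr)
    assume "v \<noteq> ?u"
    then have "(f ^^ q) v \<in> V x" using above v by auto
    then show False using v boundary_outside xc by blast
  qed
  then show "(f ^^ q) ?u \<in> {x, \<tau> x}" using v by simp
qed

lemma ret_end_inside:
  assumes x: "lnice x" and q: "(f ^^ q) c \<in> V x" "0 < q" and y: "y \<in> V (ret_end q x)"
  shows "(f ^^ q) y \<in> V x"
proof -
  obtain y' where "ret_end q x < y'" "y' \<le> c" "f y' = f y"
    using left_representative[of "ret_end q x" y] ret_end[OF x q(1)] lniceD(1)[OF x] y by auto
  then show ?thesis using ret_end(4)[OF x q(1), of y'] iter_eq[of y' y q] q by metis
qed

text \<open>An early visit at time \<open>j\<close>, which \<open>c\<close> does not make, forces
  some \<open>v\<close> between the point and \<open>c\<close> onto the boundary at that time. But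
  \<open>v\<close> still lies in the central domain, so \<open>f ^^ q\<close> sends it into
  \<open>V x\<close>, against \<open>lnice_boundary\<close>.\<close>

lemma ret_end_avoids:
  assumes x: "lnice x" and q: "first_return q x" and y: "y \<in> V (ret_end q x)"
    and j: "0 < j" "j < q"
  shows "(f ^^ j) y \<notin> V x"
proof
  assume a: "(f ^^ j) y \<in> V x"
  note r = ret_end[OF x first_returnD(2)[OF q]]
  have xc: "0 \<le> x" "x < c" using x lniceD by auto
  obtain y' where y': "ret_end q x < y'" "y' \<le> c" "f y' = f y"
    using left_representative[of "ret_end q x" y] r xc y by auto
  have "(f ^^ j) y' \<in> V x" using a iter_eq[of y' y j] y' j by auto
  moreover have "(f ^^ j) c \<notin> V x" using first_returnD(3)[OF q] j by auto
  ultimately obtain v where v: "v \<in> {y'..c}" "(f ^^ j) v \<in> {x, \<tau> x}"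
    using crossing[of y' c "f ^^ j" x] cont_iter'[of "{y'..c}" j] xc c01 y' r by auto
  have "(f ^^ q) v = (f ^^ (q - j)) ((f ^^ j) v)" using j by (simp add: iter_add)
  moreover have "(f ^^ (q - j)) ((f ^^ j) v) \<notin> V x" by (rule lnice_boundary[OF x v(2)])
  ultimately show False using r(4)[of v] v y' by auto
qed

text \<open>From time \<open>q\<close> on the orbit starts on the boundary of \<open>V x\<close>;
  before that the crossing argument of \<open>ret_end_avoids\<close> applies between the endpoint
  and \<open>c\<close>.\<close>

lemma ret_end_orbit:
  assumes x: "lnice x" and q: "first_return q x" and n: "0 < n"
  shows "(f ^^ n) (ret_end q x) \<notin> V x"
proof
  let ?u = "ret_end q x"
  assume a: "(f ^^ n) ?u \<in> V x"
  note r = ret_end[OF x first_returnD(2)[OF q]]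
  have xc: "0 \<le> x" "x < c" using x lniceD by auto
  show False
  proof (cases "q \<le> n")
    case True
    then have "(f ^^ n) ?u = (f ^^ (n - q)) ((f ^^ q) ?u)" by (simp add: iter_add)
    then show False using a lnice_boundary[OF x r(3)] by auto
  next
    case False
    then have "(f ^^ n) c \<notin> V x" using first_returnD(3)[OF q] n by auto
    then obtain v where v: "v \<in> {?u..c}" "(f ^^ n) v \<in> {x, \<tau> x}"
      using crossing[of ?u c "f ^^ n" x] cont_iter'[of "{?u..c}" n] xc c01 r a by auto
    have "v \<noteq> ?u" using v a boundary_outside xc by blast
    then have "(f ^^ q) v \<in> V x" using r(4)[of v] v by auto
    moreover have "(f ^^ q) v = (f ^^ (q - n)) ((f ^^ n) v)" using False by (simp add: iter_add)
    ultimately show False using lnice_boundary[OF x v(2)] by auto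
  qed
qed

lemma ret_end_nice:
  assumes x: "lnice x" and q: "first_return q x"
  shows "lnice (ret_end q x)"
proof -
  note r = ret_end[OF x first_returnD(2)[OF q]]
  have xc: "0 \<le> x" "x < c" using x lniceD by auto
  have "(f ^^ n) (ret_end q x) \<notin> V (ret_end q x)" for n
    using ret_end_orbit[OF x q, of n] V_mono[of x "ret_end q x"] r xc boundary_outside[of "ret_end q x"]
    by (cases "n = 0") auto
  then show ?thesis using r xc by (auto simp: lnice_def)
qed

text \<open>Neither endpoint ever returns to \<open>V x\<close>, so both lie outside the return
  domain and cut its central component off exactly there.\<close>

lemma Uint_ret_end:
  assumes x: "lnice x" and q: "first_return q x"
  shows "Uint f c x = V (ret_end q x)"
proof
  let ?u = "ret_end q x"
  note r = ret_end[OF x first_returnD(2)[OF q]]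
  have xc: "0 \<le> x" "x < c" using x lniceD by auto
  have u: "0 \<le> ?u" "?u < c" using r xc by auto
  have "V ?u \<subseteq> return_domain f c x"
  proof
    fix y assume y: "y \<in> V ?u"
    have "(f ^^ q) y \<in> V x" using ret_end_inside[OF x _ _ y] first_returnD[OF q] by auto
    moreover have "y \<in> V x" using y V_mono r xc by blast
    ultimately show "y \<in> return_domain f c x"
      unfolding return_domain_def using first_returnD(1)[OF q] by (auto intro!: exI[of _ q])
  qed
  then show "V ?u \<subseteq> Uint f c x" unfolding Uint_def
    using V_left[OF u] c_in_V[OF u] by (intro connected_component_maximal) auto
  have ut: "?u \<notin> return_domain f c x" "\<tau> ?u \<notin> return_domain f c x"
    using ret_end_orbit[OF x q] iter_eq[OF tau_left(3)[OF u]] by (auto simp: return_domain_def)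
  have sub: "Uint f c x \<subseteq> return_domain f c x" unfolding Uint_def by (rule connected_component_subset)
  have "c \<in> Uint f c x" using \<open>V ?u \<subseteq> Uint f c x\<close> c_in_V[OF u] by auto
  moreover have "connected (Uint f c x)" unfolding Uint_def by simp
  ultimately show "Uint f c x \<subseteq> V ?u"
    using connectedD_interval[of "Uint f c x" _ c ?u] connectedD_interval[of "Uint f c x" c _ "\<tau> ?u"]
      ut sub V_left[OF u] tau_left(1)[OF u] u
    by (smt (verit, ccfv_threshold) greaterThanLessThan_iff subset_iff)
qed

text \<open>If the orbit of \<open>a\<close> entered the open set \<open>V a\<close>, so would the
  orbit of a nearby \<open>X k\<close>, and \<open>V a\<close> is contained in
  \<open>V (X k)\<close>.\<close>

lemma lnice_limit:
  assumes X: "\<And>n. lnice (X n)" and lim: "X \<longlonglongrightarrow> a" and le: "\<And>n. X n \<le> a" and a: "a < c"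
  shows "lnice a"
proof -
  have a0: "0 \<le> a" using le[of 0] lniceD(1)[OF X[of 0]] by simp
  have "(f ^^ n) a \<notin> V a" for n
  proof
    assume in_V: "(f ^^ n) a \<in> V a"
    have "((\<lambda>k. (f ^^ n) (X k)) \<longlongrightarrow> (f ^^ n) a) sequentially"
    proof (rule continuous_on_tendsto_compose[OF cont_iter lim])
      show "a \<in> {0..1}" using a a0 c01 by auto
      show "\<forall>\<^sub>F k in sequentially. X k \<in> {0..1}"
        using lniceD(1,2)[OF X] c01
        by (intro always_eventually allI) (meson atLeastAtMost_iff less_imp_le order.trans)
    qed
    moreover have "open (V a)" using V_left a a0 by simp
    ultimately have "\<forall>\<^sub>F k in sequentially. (f ^^ n) (X k) \<in> V a"
      using in_V by (rule topological_tendstoD)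
    then obtain k where "(f ^^ n) (X k) \<in> V a" by (auto simp: eventually_sequentially)
    then have "(f ^^ n) (X k) \<in> V (X k)" using V_mono[of "X k" a] le a lniceD(1)[OF X] by blast
    then show False using lniceD(3)[OF X] by blast
  qed
  then show ?thesis using a a0 by (auto simp: lnice_def)
qed

end

locale recurrent_unimodal = unimodal +
  assumes rec: "recurrent_pt f c" and np: "\<not> periodic_pt f c"
begin

lemma crit_orbit_ne: "n > 0 \<Longrightarrow> (f ^^ n) c \<noteq> c"
  using np unfolding periodic_pt_def by (metis Suc_leI One_nat_def)

lemma first_return_exists:
  assumes "0 \<le> x" "x < c"
  obtains q where "first_return q x"
proof -
  define P where "P n \<longleftrightarrow> 0 < n \<and> (f ^^ n) c \<in> V x" for n
  have V: "V x = {x<..<\<tau> x}" "x < c" "c < \<tau> x" using assms V_left tau_left by auto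
  define e where "e = min (c - x) (\<tau> x - c)"
  have "e > 0" using V by (simp add: e_def)
  then obtain n where "n \<ge> 1" "\<bar>(f ^^ n) c - c\<bar> < e" using rec by (auto simp: recurrent_pt_def)
  then have "P n" using V by (auto simp: P_def e_def)
  then have "P (LEAST n. P n)" "\<And>j. j < (LEAST n. P n) \<Longrightarrow> \<not> P j"
    using not_less_Least by (metis LeastI)+
  then have "first_return (LEAST n. P n) x" by (auto simp: first_return_def P_def)
  then show ?thesis using that by blast
qed

text \<open>Otherwise there is a largest nice point \<open>a\<close> on the left. Its interval is
  invariant under the return map, which has no fixed point inside, so the critical orbit moves
  monotonically under that map and cannot come back close to \<open>c\<close>.\<close>

lemma nice_points_accumulate:
  assumes "e < c"
  shows "\<exists>x. lnice x \<and> e < x"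
proof (rule ccontr)
  assume none: "\<not> ?thesis"
  define N where "N = {x. lnice x}"
  define a where "a = Sup N"
  have N0: "0 \<in> N" 
  proof -
    have "V 0 = {0<..<\<tau> 0}" using V_left[of 0] c01 by simp
    then show ?thesis using c01 by (simp add: N_def lnice_def iter_zero)
  qed
  have Ne: "x \<le> e" if "x \<in> N" for x using none that by (force simp: N_def)
  then have bd: "bdd_above N" by (intro bdd_aboveI) 
  have ae: "a \<le> e" unfolding a_def by (rule cSup_least) (use N0 Ne in auto)
  have Na: "x \<le> a" if "x \<in> N" for x unfolding a_def using cSup_upper[OF that bd] .
  have ac: "a < c" using ae assms by simp
  have "a \<in> closure N" unfolding a_def by (rule closure_contains_Sup) (use N0 bd in auto)
  then obtain X where X: "\<And>n. X n \<in> N" "X \<longlonglongrightarrow> a" unfolding closure_sequential by blast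
  have la: "lnice a" by (rule lnice_limit[of X]) (use X Na ac N_def in auto)
  have a0: "0 \<le> a" using la lniceD by auto
  obtain q where q: "first_return q a" using first_return_exists[OF a0 ac] .
  note r = ret_end[OF la first_returnD(2)[OF q]]
  have q0: "0 < q" using first_returnD(1)[OF q] .
  have "ret_end q a \<in> N" using ret_end_nice[OF la q] by (simp add: N_def)
  then have ua: "ret_end q a = a" using Na r(1) by fastforce
  have V: "V a = {a<..<\<tau> a}" "c < \<tau> a" "\<tau> a \<le> 1" using V_left tau_left a0 ac by auto
  have inv: "(f ^^ q) y \<in> V a" if "y \<in> V a" for y
    using ret_end_inside[OF la first_returnD(2)[OF q] q0, of y] that ua by simp
  have avoid: "(f ^^ j) y \<notin> V a" if "y \<in> V a" "0 < j" "j < q" for y j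
    using ret_end_avoids[OF la q, of y j] that ua by simp
  have mult: "(f ^^ (q * k)) c \<in> V a" for k
  proof (induction k)
    case 0
    then show ?case using c_in_V a0 ac by simp
  next
    case (Suc k)
    have "(f ^^ (q * Suc k)) c = (f ^^ q) ((f ^^ (q * k)) c)" by (simp add: iter_add)
    then show ?case using inv Suc by simp
  qed
  have visits: "q dvd n" if "(f ^^ n) c \<in> V a" for n
  proof (rule ccontr)
    assume "\<not> q dvd n"
    then have "0 < n mod q" "n mod q < q" using q0 by (auto simp: dvd_eq_mod_eq_0)
    from avoid[OF mult this, of "n div q"] show False using that by (simp add: iter_add)
  qed
  \<comment> \<open>A fixed point would have a left representative \<open>p'\<close> beyond
    \<open>a\<close>. It would be nice: visits to \<open>V a\<close> happen only at multiples of
    \<open>q\<close>, when the orbit sits at \<open>p\<close>, on the boundary of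
    \<open>V p'\<close>.\<close>
  have nofix: "(f ^^ q) p \<noteq> p" if p: "p \<in> V a" for p
  proof
    assume fix_p: "(f ^^ q) p = p"
    have "p \<noteq> c" using fix_p crit_orbit_ne q0 by auto
    obtain p' where p': "a < p'" "p' \<le> c" "f p' = f p" using left_representative[OF a0 ac p] .
    have "p' \<noteq> c"
    proof
      assume "p' = c"
      then show False using p' incr[of p c] decr[of c p] \<open>p \<noteq> c\<close> p V a0 by (cases "p < c") auto
    qed
    then have p'c: "p' < c" using p' by auto
    have pp: "p \<in> {p', \<tau> p'}" using tau_unique[of p' p] p' p'c p V a0 by auto
    have "(f ^^ n) p' \<notin> V p'" for n
    proof
      assume n: "(f ^^ n) p' \<in> V p'"
      then have n0: "0 < n" using boundary_outside[of p'] p' p'c a0 by (cases n) auto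
      have fn: "(f ^^ n) p' = (f ^^ n) p" using iter_eq p'(3) n0 by blast
      have per: "(f ^^ (q * k)) p = p" for k
        by (induction k) (simp_all add: fix_p iter_add[symmetric] )
      have "(f ^^ n) p = (f ^^ (n mod q)) p"
        using iter_add[of "n mod q" "q * (n div q)" p] per by simp
      moreover have "(f ^^ n) p \<in> V a" using n fn V_mono[of a p'] a0 p' p'c by auto
      ultimately have "n mod q = 0" using avoid[OF p, of "n mod q"] q0 by (cases "n mod q = 0") auto
      then have "(f ^^ n) p = p" using \<open>(f ^^ n) p = (f ^^ (n mod q)) p\<close> by simp
      then show False using n fn boundary_outside[of p' p] pp p' p'c a0 by auto
    qed
    then have "p' \<in> N" using p' p'c a0 by (auto simp: N_def lnice_def)
    then show False using Na p' by force
  qed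
  have C: "continuous_on {a..\<tau> a} (f ^^ q)" using cont_iter' a0 V by auto
  have cV: "c \<in> V a" using c_in_V a0 ac by auto
  have sep: "(\<forall>y\<in>V a. (f ^^ q) y < y) \<or> (\<forall>y\<in>V a. (f ^^ q) y > y)"
  proof (rule ccontr)
    assume "\<not> ?thesis"
    then obtain y z where yz: "y \<in> V a" "z \<in> V a" "(f ^^ q) y - y \<ge> 0" "(f ^^ q) z - z \<le> 0"
      by (force simp: not_less)
    have cn: "connected ((\<lambda>y. (f ^^ q) y - y) ` V a)"
      by (intro connected_continuous_image continuous_intros continuous_on_subset[OF C]) (auto simp: V)
    have "0 \<in> (\<lambda>y. (f ^^ q) y - y) ` V a" using connectedD_interval[OF cn, of "(f ^^ q) z - z" "(f ^^ q) y - y" 0] yz by auto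
    then show False using nofix by auto
  qed
  have close: "\<exists>k>0. \<bar>(f ^^ (q * k)) c - c\<bar> < e'" if "e' > 0" for e'
  proof -
    define d where "d = min e' (min (c - a) (\<tau> a - c))"
    have "d > 0" using that V ac by (auto simp: d_def)
    then obtain n where n: "n \<ge> 1" "\<bar>(f ^^ n) c - c\<bar> < d" using rec by (auto simp: recurrent_pt_def)
    then have "(f ^^ n) c \<in> V a" using V by (auto simp: d_def)
    then obtain k where k: "n = q * k" using visits by (auto elim: dvdE)
    then have "k > 0" using n by (cases k) auto
    then show ?thesis using n k by (auto simp: d_def)
  qed
  \<comment> \<open>In a monotone motion every later point is at least as far from \<open>c\<close>
    as the first step, at distance \<open>d\<close>; recurrence asks for a closer one.\<close>
  define d where "d = \<bar>(f ^^ q) c - c\<bar>"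
  have "d > 0" using crit_orbit_ne q0 by (simp add: d_def)
  then obtain k where k: "k > 0" "\<bar>(f ^^ (q * k)) c - c\<bar> < d" using close by blast
  have "(f ^^ (q * Suc m)) c = (f ^^ q) ((f ^^ (q * m)) c)" for m by (simp add: iter_add)
  note mS = this
  from sep show False
  proof
    assume lt: "\<forall>y\<in>V a. (f ^^ q) y < y"
    have "(f ^^ (q * Suc m)) c \<le> (f ^^ q) c" for m
    proof (induction m)
      case (Suc m)
      have "(f ^^ (q * Suc (Suc m))) c < (f ^^ (q * Suc m)) c" unfolding mS[of "Suc m"] using lt mult by blast
      then show ?case using Suc by simp
    qed simp
    from this[of "k - 1"] k have "(f ^^ (q * k)) c \<le> (f ^^ q) c" by simp
    then show False using k lt cV by (auto simp: d_def)
  next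
    assume gt: "\<forall>y\<in>V a. (f ^^ q) y > y"
    have "(f ^^ (q * Suc m)) c \<ge> (f ^^ q) c" for m
    proof (induction m)
      case (Suc m)
      have "(f ^^ (q * Suc (Suc m))) c > (f ^^ (q * Suc m)) c" unfolding mS[of "Suc m"] using gt mult by blast
      then show ?case using Suc by simp
    qed simp
    from this[of "k - 1"] k have "(f ^^ (q * k)) c \<ge> (f ^^ q) c" by simp
    then show False using k gt cV by (auto simp: d_def)
  qed
qed

end

section \<open>Cascades of central returns\<close>

context unimodal begin

text \<open>Symmetric intervals are superlevel sets of \<open>f\<close>; comparing heights replaces
  case distinctions about the two sides of \<open>c\<close> and passes to limits easily.\<close>

lemma V_iff:
  assumes w: "0 \<le> w" "w < c" and y: "y \<in> {0..1}"
  shows "y \<in> V w \<longleftrightarrow> f w < f y"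
proof -
  note t = tau_left[OF w]
  have "f w < f y" if "w < y" "y < \<tau> w"
    using incr[of w y] decr[of y "\<tau> w"] that w t by (cases "y \<le> c") auto
  moreover have "f y \<le> f w" if "y \<le> w" using incr[of y w] that w y by (cases "y = w") auto
  moreover have "f y \<le> f w" if "\<tau> w \<le> y" using decr[of "\<tau> w" y] that t y by (cases "y = \<tau> w") auto
  ultimately show ?thesis unfolding V_left[OF w] greaterThanLessThan_iff by linarith
qed

lemma boundary_iff:
  assumes w: "0 \<le> w" "w < c" and y: "y \<in> {0..1}"
  shows "y \<in> {w, \<tau> w} \<longleftrightarrow> f y = f w"
  using tau_unique[OF w y] tau_left[OF w] by auto

lemma Icc_iff:
  assumes w: "0 \<le> w" "w < c" and y: "y \<in> {0..1}"
  shows "y \<in> {w..\<tau> w} \<longleftrightarrow> f w \<le> f y"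
proof -
  have "y \<in> {w..\<tau> w} \<longleftrightarrow> y \<in> V w \<or> y \<in> {w, \<tau> w}"
    using V_left[OF w] tau_left[OF w] w by auto
  then show ?thesis unfolding V_iff[OF assms] boundary_iff[OF assms] by auto
qed

lemma finite_fibre: "finite {z \<in> {0..1}. (f ^^ n) z = w}"
proof (induction n arbitrary: w)
  case 0
  then show ?case by (rule finite_subset[of _ "{w}"]) auto
next
  case (Suc n)
  have i1: "inj_on f {0..c}" by (rule linorder_inj_onI) (use incr in \<open>force+\<close>)
  have i2: "inj_on f {c..1}" by (rule linorder_inj_onI) (use decr in \<open>force+\<close>)
  have "{u \<in> {0..1}. f u = w} = (f -` {w} \<inter> {0..c}) \<union> (f -` {w} \<inter> {c..1})"
    using c01 by auto
  then have fin: "finite {u \<in> {0..1}. f u = w}"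
    using finite_vimage_IntI[OF _ i1, of "{w}"] finite_vimage_IntI[OF _ i2, of "{w}"] by simp
  have "{z \<in> {0..1}. (f ^^ Suc n) z = w} \<subseteq> (\<Union>u\<in>{u \<in> {0..1}. f u = w}. {z \<in> {0..1}. (f ^^ n) z = u})"
    using iter_range by (auto simp del: atLeastAtMost_iff)
  then show ?case by (rule finite_subset) (intro finite_UN_I fin Suc)
qed

text \<open>The time \<open>q\<close> stays fixed while the interval shrinks. As long as
  \<open>f ^^ q\<close> sends \<open>c\<close> inside, these are the successive central return
  domains with the same return time.\<close>

definition cascade :: "nat \<Rightarrow> real \<Rightarrow> nat \<Rightarrow> real" where
  "cascade q x j = (ret_end q ^^ j) x"

lemma cascade_simps: "cascade q x 0 = x" "cascade q x (Suc j) = ret_end q (cascade q x j)"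
  by (auto simp: cascade_def)

lemma cascade_props:
  assumes "lnice x" "first_return q x" "\<And>i. i \<le> j \<Longrightarrow> (f ^^ q) c \<in> V (cascade q x i)"
  shows "lnice (cascade q x j) \<and> x \<le> cascade q x j \<and> first_return q (cascade q x j)"
  using assms(3)
proof (induction j)
  case 0
  then show ?case using assms by (simp add: cascade_simps)
next
  case (Suc j)
  let ?y = "cascade q x j"
  have IH: "lnice ?y" "x \<le> ?y" "first_return q ?y" using Suc by auto
  have n: "lnice (ret_end q ?y)" by (rule ret_end_nice[OF IH(1,3)])
  have le: "?y \<le> ret_end q ?y" by (rule ret_end(1)[OF IH(1) first_returnD(2)[OF IH(3)]])
  have "V (ret_end q ?y) \<subseteq> V x"
    using V_mono[of x "ret_end q ?y"] le IH lniceD(1,2)[OF n] lniceD(1)[OF assms(1)] by auto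
  moreover have "(f ^^ q) c \<in> V (ret_end q ?y)" using Suc.prems[of "Suc j"] by (simp add: cascade_simps)
  ultimately have "first_return q (ret_end q ?y)" using assms(2) by (auto simp: first_return_def)
  then show ?case using n le IH by (simp add: cascade_simps)
qed

lemma cascade_Suc_nice:
  assumes "lnice x" "first_return q x" "\<And>i. i \<le> j \<Longrightarrow> (f ^^ q) c \<in> V (cascade q x i)"
  shows "lnice (cascade q x (Suc j))"
  unfolding cascade_simps by (rule ret_end_nice) (use cascade_props[OF assms] in auto)

lemma cascade_inside:
  assumes "lnice x" "first_return q x" "\<And>i. i \<le> j \<Longrightarrow> (f ^^ q) c \<in> V (cascade q x i)"
    and "y \<in> V (cascade q x (Suc j))"
  shows "(f ^^ q) y \<in> V (cascade q x j)"
  using ret_end_inside[of "cascade q x j" q y] cascade_props[OF assms(1,2), of j] assms(3,4)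
    first_returnD(1)[OF assms(2)] by (auto simp: cascade_simps)

lemma cascade_boundary:
  assumes "lnice x" "first_return q x" "\<And>i. i \<le> j \<Longrightarrow> (f ^^ q) c \<in> V (cascade q x i)"
  shows "(f ^^ q) (cascade q x (Suc j)) \<in> {cascade q x j, \<tau> (cascade q x j)}"
  unfolding cascade_simps 
  by (rule ret_end(3)) (use cascade_props[OF assms(1,2), of j] assms(3) in auto)

lemma cascade_mono:
  assumes "lnice x" "first_return q x" "\<And>i. i \<le> j \<Longrightarrow> (f ^^ q) c \<in> V (cascade q x i)"
  shows "cascade q x j \<le> cascade q x (Suc j)"
  unfolding cascade_simps
  by (rule ret_end(1)) (use cascade_props[OF assms(1,2), of j] assms(3) in auto)

text \<open>The left endpoints increase to some \<open>a < c\<close>, and {a..\<tau> a} is the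
  periodic interval: \<open>f ^^ q\<close> loses only one level of the cascade, which in the limit
  becomes invariance.\<close>

lemma infinite_cascade_renormalizable:
  assumes x: "lnice x" and q: "first_return q x" "2 \<le> q" and ne: "(f ^^ q) c \<noteq> c"
    and inf: "\<And>j. (f ^^ q) c \<in> V (cascade q x j)"
  shows "renormalizable_period f c q"
proof -
  let ?X = "cascade q x"
  have X: "lnice (?X j)" "x \<le> ?X j" for j using cascade_props[OF x q(1) inf] by auto
  have X01: "0 \<le> ?X j" "?X j < c" for j using lniceD X by auto
  have q0: "0 < q" using q by simp
  have "incseq ?X" using cascade_mono[OF x q(1) inf] by (rule incseq_SucI)
  moreover have "?X j \<le> c" for j using X01[of j] by simp
  ultimately obtain a where a: "?X \<longlonglongrightarrow> a" "\<And>j. ?X j \<le> a"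
    using incseq_convergent[of ?X c] by metis
  have ac: "a \<le> c" by (rule LIMSEQ_le_const2[OF a(1)]) (use X01 less_imp_le in blast)
  have a0: "0 \<le> a" using X01(1)[of 0] a(2)[of 0] by simp
  have lim: "(\<lambda>j. f (?X j)) \<longlonglongrightarrow> f a"
    by (rule continuous_on_tendsto_compose[OF cont_f a(1)])
       (use a0 ac c01 order.strict_trans[OF X01(2) c01(2)] X01(1) in \<open>auto intro!: always_eventually simp: less_imp_le\<close>)
  \<comment> \<open>With \<open>a = c\<close> the point \<open>f ^^ q\<close> of \<open>c\<close>,
    lying in every level, would have height \<open>f c\<close> and so equal
    \<open>c\<close>.\<close>
  have "a \<noteq> c"
  proof
    assume "a = c"
    have r: "(f ^^ q) c \<in> {0..1}" using iter_range c01 by simp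
    have "f (?X j) < f ((f ^^ q) c)" for j using inf V_iff[OF X01 r] by blast
    then have "f c \<le> f ((f ^^ q) c)" using LIMSEQ_le_const2[OF lim] \<open>a = c\<close> less_imp_le by blast
    then show False using incr[of "(f ^^ q) c" c] decr[of c "(f ^^ q) c"] ne r
      by (cases "(f ^^ q) c < c") auto
  qed
  then have ac': "a < c" using ac by simp
  have la: "lnice a" by (rule lnice_limit[OF X(1) a(1,2) ac'])
  note ta = tau_left[OF a0 ac']
  have r: "y \<in> {0..1}" "(f ^^ n) y \<in> {0..1}" if "y \<in> {a..\<tau> a}" for n y 
  proof -
    show "y \<in> {0..1}" using that a0 ta by auto
    then show "(f ^^ n) y \<in> {0..1}" by (rule iter_range)
  qed
  have fXa: "f (?X j) \<le> f a" for j using incr[of "?X j" a] a(2)[of j] X01[of j] ac' by (cases "?X j = a") auto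
  have inv: "(f ^^ q) y \<in> {a..\<tau> a}" if y: "y \<in> {a..\<tau> a}" for y
  proof -
    have fy: "f a \<le> f y" using Icc_iff[OF a0 ac' r(1)[OF y]] y by simp
    have "f (?X j) \<le> f ((f ^^ q) y)" for j
    proof (cases "f (?X (Suc j)) < f y")
      case True
      then have "y \<in> V (?X (Suc j))" using V_iff[OF X01 r(1)[OF y]] by simp
      then have "(f ^^ q) y \<in> V (?X j)" by (rule cascade_inside[OF x q(1) inf])
      then show ?thesis using V_iff[OF X01 r(2)[OF y]] by fastforce
    next
      case False
      then have "f y = f (?X (Suc j))" using fy fXa[of "Suc j"] by simp
      then have "(f ^^ q) y = (f ^^ q) (?X (Suc j))" using iter_eq q0 by blast
      moreover have "(f ^^ q) (?X (Suc j)) \<in> {?X j, \<tau> (?X j)}" by (rule cascade_boundary[OF x q(1) inf])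
      ultimately show ?thesis using tau_left(3)[OF X01] by auto
    qed
    then have "f a \<le> f ((f ^^ q) y)" using LIMSEQ_le_const2[OF lim] by blast
    then show ?thesis using Icc_iff[OF a0 ac' r(2)[OF y]] by simp
  qed
  have avoid: "(f ^^ j) y \<notin> V a" if y: "y \<in> {a..\<tau> a}" and j: "0 < j" "j < q" for y j
  proof (cases "f a < f y")
    case True
    then have "y \<in> V a" using V_iff[OF a0 ac' r(1)[OF y]] by simp
    then have "y \<in> V (ret_end q x)" using V_mono[OF X01(1) a(2) ac', of 1] by (auto simp: cascade_simps)
    then have "(f ^^ j) y \<notin> V x" by (rule ret_end_avoids[OF x q(1) _ j])
    then show ?thesis using V_mono[of x a] a(2)[of 0] lniceD(1)[OF x] ac' by (auto simp: cascade_simps)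
  next
    case False
    then have "f y = f a" using Icc_iff[OF a0 ac' r(1)[OF y]] y by simp
    then have "(f ^^ j) y = (f ^^ j) a" using iter_eq j by blast
    then show ?thesis using lniceD(3)[OF la] by simp
  qed
  \<comment> \<open>A point common to both interiors is sent by \<open>f ^^ (q - j)\<close> into
    {a..\<tau> a} but not into \<open>V a\<close>, hence to the boundary. The overlap is open and
    contained in a finite fibre, so it is empty.\<close>
  have dis: "interior ((f ^^ i) ` {a..\<tau> a}) \<inter> interior ((f ^^ j) ` {a..\<tau> a}) = {}" (is "?O = {}")
    if ij: "i < j" "j < q" for i j
  proof (rule ccontr)
    assume "?O \<noteq> {}"
    have "f ((f ^^ (q - j)) z) = f a" if z: "z \<in> ?O" for z
    proof -
      have "z \<in> (f ^^ i) ` {a..\<tau> a}" "z \<in> (f ^^ j) ` {a..\<tau> a}" using z interior_subset by blast+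
      then obtain y1 y2 where y: "y1 \<in> {a..\<tau> a}" "z = (f ^^ i) y1" "y2 \<in> {a..\<tau> a}" "z = (f ^^ j) y2" by blast
      have "i \<noteq> 0"
      proof
        assume "i = 0"
        then have "z \<in> interior {a..\<tau> a}" using z by simp
        then have "z \<in> V a" using V_left[OF a0 ac'] by simp
        then show False using avoid[OF y(3), of j] y ij by auto
      qed
      have "(f ^^ (q - j)) z = (f ^^ q) y2" unfolding y(4) using ij by (simp add: iter_add)
      then have 1: "(f ^^ (q - j)) z \<in> {a..\<tau> a}" using inv[OF y(3)] by simp
      have "(f ^^ (q - j)) z = (f ^^ (q - j + i)) y1" unfolding y(2) by (simp only: iter_add)
      then have 2: "(f ^^ (q - j)) z \<notin> V a" using avoid[OF y(1), of "q - j + i"] ij \<open>i \<noteq> 0\<close> by simp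
      have "(f ^^ (q - j)) z \<in> {0..1}" using r(1)[OF 1] .
      from V_iff[OF a0 ac' this] Icc_iff[OF a0 ac' this] 1 2 show ?thesis by simp
    qed
    moreover have "?O \<subseteq> {0..1}" using interior_subset r(2) by blast
    ultimately have "?O \<subseteq> {z \<in> {0..1}. (f ^^ Suc (q - j)) z = f a}" by auto
    then have "finite ?O" using finite_fibre finite_subset by blast
    moreover have "open ?O" by (intro open_Int open_interior)
    ultimately show False using finite_imp_not_open \<open>?O \<noteq> {}\<close> by blast
  qed
  show ?thesis unfolding renormalizable_period_def
    using q(2) a0 ac' ta inv dis by (intro conjI exI[of _ a] exI[of _ "\<tau> a"]) auto
qed

text \<open>The condition \<open>f b \<le> t1\<close> says that the pullback of the branch by \<open>f\<close> stays inside \<open>V b\<close>.\<close>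

definition extends_to :: "real \<Rightarrow> real \<Rightarrow> nat \<Rightarrow> bool" where
  "extends_to x b q \<longleftrightarrow> (\<exists>t1 t2. mono_branch (q - 1) t1 t2 \<and> t1 < f c \<and> f c < t2 \<and> f b \<le> t1 \<and>
     {(f ^^ (q - 1)) t1, (f ^^ (q - 1)) t2} = {x, \<tau> x})"

lemma cascade_orbit:
  assumes x: "lnice x" and q: "first_return q x"
    and cen: "\<And>i. i \<le> k \<Longrightarrow> (f ^^ q) c \<in> V (cascade q x i)"
    and r: "r \<le> k"
  shows "(f ^^ (Suc r * q)) c \<in> V (cascade q x (k - r))"
  using r
proof (induction r)
  case 0
  then show ?case using cen by simp
next
  case (Suc r)
  have "(f ^^ (Suc (Suc r) * q)) c = (f ^^ q) ((f ^^ (Suc r * q)) c)" by (simp only: iter_add mult_Suc)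
  moreover have "k - r = Suc (k - Suc r)" using Suc.prems by simp
  ultimately show ?case using cascade_inside[OF x q, of "k - Suc r" "(f ^^ (Suc r * q)) c"] cen Suc by auto
qed

text \<open>Boundaries move out exactly one level per return, so after \<open>Suc k\<close> returns
  the boundary of the last interval reaches that of \<open>V x\<close>.\<close>

lemma cascade_boundary_orbit:
  assumes x: "lnice x" and q: "first_return q x"
    and cen: "\<And>i. i \<le> k \<Longrightarrow> (f ^^ q) c \<in> V (cascade q x i)"
    and v: "v \<in> {cascade q x (Suc k), \<tau> (cascade q x (Suc k))}"
    and r: "r \<le> k"
  shows "(f ^^ (Suc r * q)) v \<in> {cascade q x (k - r), \<tau> (cascade q x (k - r))}"
  using r
proof (induction r)
  case 0
  have n: "0 \<le> cascade q x (Suc k)" "cascade q x (Suc k) < c"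
    using cascade_Suc_nice[OF x q cen] lniceD by auto
  have "f v = f (cascade q x (Suc k))" using v tau_left[OF n] by auto
  then have "(f ^^ q) v = (f ^^ q) (cascade q x (Suc k))" using iter_eq first_returnD(1)[OF q] by blast
  then show ?case using cascade_boundary[OF x q cen] by simp
next
  case (Suc r)
  have e: "(f ^^ (Suc (Suc r) * q)) v = (f ^^ q) ((f ^^ (Suc r * q)) v)" by (simp only: iter_add mult_Suc)
  have k: "k - r = Suc (k - Suc r)" using Suc.prems by simp
  let ?w = "cascade q x (k - r)"
  have n: "0 \<le> ?w" "?w < c" using cascade_props[OF x q, of "k - r"] cen lniceD(1,2) by auto
  have IH: "(f ^^ (Suc r * q)) v \<in> {?w, \<tau> ?w}" using Suc by simp
  then have "f ((f ^^ (Suc r * q)) v) = f ?w" using tau_left[OF n] by auto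
  then have "(f ^^ q) ((f ^^ (Suc r * q)) v) = (f ^^ q) ?w" using iter_eq first_returnD(1)[OF q] by blast
  then show ?case using cascade_boundary[OF x q, of "k - Suc r"] cen e k by auto
qed

end

section \<open>Extension of the first return branch\<close>

context recurrent_unimodal begin

text \<open>A point of the central domain hitting \<open>c\<close> at a positive time below
  \<open>q\<close> would be in \<open>V x\<close> too early.\<close>

lemma first_return_mono_branch:
  assumes x: "lnice x" and q: "first_return q x"
  shows "mono_branch q (ret_end q x) c"
proof -
  note r = ret_end[OF x first_returnD(2)[OF q]]
  have xc: "0 \<le> x" "x < c" using x lniceD by auto
  have "c \<notin> (f ^^ j) ` {ret_end q x<..<c}" if "j < q" for j
  proof
    assume "c \<in> (f ^^ j) ` {ret_end q x<..<c}"
    then obtain y where y: "ret_end q x < y" "y < c" "(f ^^ j) y = c" by auto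
    then have "j \<noteq> 0" by (cases j) auto
    have "y \<in> V (ret_end q x)" using V_left[of "ret_end q x"] tau_left(1)[of "ret_end q x"] r(1,2) xc y by auto
    then have "(f ^^ j) y \<notin> V x" using ret_end_avoids[OF x q] that \<open>j \<noteq> 0\<close> by auto
    then show False using y c_in_V xc by auto
  qed
  then show ?thesis using r xc c01 by (auto simp: mono_branch_def)
qed

context
  fixes x :: real and q k q' :: nat and b :: real
  assumes x: "lnice x" and q: "first_return q x"
    and cen: "\<And>i. i \<le> k \<Longrightarrow> (f ^^ q) c \<in> V (cascade q x i)"
    and b_def: "b = cascade q x (Suc k)" and out: "(f ^^ q) c \<notin> V b"
    and q': "first_return q' b"
begin

lemma cascade_nice: "i \<le> Suc k \<Longrightarrow> lnice (cascade q x i)"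
  using cascade_props[OF x q, of i] cascade_Suc_nice[OF x q, of k] cen 
  by (cases "i = Suc k") auto

lemma cascade_le: "i \<le> j \<Longrightarrow> j \<le> Suc k \<Longrightarrow> cascade q x i \<le> cascade q x j"
proof (induction j)
  case (Suc j)
  then show ?case using cascade_mono[OF x q, of j] cen by (cases "i = Suc j") force+
qed simp

lemma cascade_V: "i \<le> j \<Longrightarrow> j \<le> Suc k \<Longrightarrow> V (cascade q x j) \<subseteq> V (cascade q x i)"
  using V_mono[OF _ cascade_le] cascade_nice lniceD by auto

lemma b_nice: "lnice b"
  using cascade_nice b_def by simp

lemma x_less_b: "x < b"
proof -
  have "x \<le> b" using cascade_le[of 0 "Suc k"] by (simp add: b_def cascade_simps(1))
  moreover have "x \<noteq> b" using out first_returnD(2)[OF q] by auto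
  ultimately show ?thesis by simp
qed

text \<open>At the times \<open>d * q\<close> with \<open>d\<close> at most \<open>k\<close> the
  critical orbit is still in \<open>V (ret_end q x)\<close>, and strictly between returns points of
  that domain avoid \<open>V x\<close>.\<close>

lemma visit_times:
  assumes i: "0 < i" "(f ^^ i) c \<in> V x"
  shows "Suc k * q \<le> i \<or> (\<exists>r<k. i = Suc r * q)"
proof (rule disjCI)
  assume no: "\<not> (\<exists>r<k. i = Suc r * q)"
  show "Suc k * q \<le> i"
  proof (rule ccontr)
    assume "\<not> ?thesis"
    then have ik: "i < Suc k * q" by simp
    have q0: "0 < q" using first_returnD(1)[OF q] .
    define d where "d = i div q"
    have id: "i = d * q + i mod q" by (simp add: d_def)
    have "d \<le> k" using ik q0 unfolding d_def by (metis less_Suc_eq_le less_mult_imp_div_less)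
    have W: "(f ^^ (d * q)) c \<in> V (ret_end q x)"
    proof (cases d)
      case 0
      then show ?thesis using c_in_V[of "ret_end q x"] ret_end_nice[OF x q] lniceD by auto
    next
      case (Suc r)
      then have "(f ^^ (d * q)) c \<in> V (cascade q x (k - r))"
        using cascade_orbit[OF x q, of k r] cen \<open>d \<le> k\<close> by auto
      moreover have "V (cascade q x (k - r)) \<subseteq> V (cascade q x 1)"
        by (rule cascade_V) (use Suc \<open>d \<le> k\<close> in auto)
      ultimately show ?thesis by (auto simp: cascade_simps)
    qed
    have "(f ^^ i) c = (f ^^ (i mod q)) ((f ^^ (d * q)) c)" using id by (simp add: iter_add add.commute)
    then have "i mod q = 0"
      using ret_end_avoids[OF x q W, of "i mod q"] i q0 by (cases "i mod q = 0") auto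
    then have "i = d * q" using id by simp
    moreover then obtain r where "d = Suc r" using i by (cases d) auto
    ultimately show False using no \<open>d \<le> k\<close> by (metis Suc_le_eq)
  qed
qed

text \<open>Late visits come after the boundary of \<open>V b\<close> has reached that of
  \<open>V x\<close>, so \<open>w = x\<close> serves. At an early visit that boundary lies on the
  boundary of a cascade level, which serves as \<open>w\<close>.\<close>

lemma boundary_separated:
  assumes i: "0 < i" "(f ^^ i) c \<in> V x" and v: "v \<in> {b, \<tau> b}"
  shows "\<exists>w. 0 \<le> w \<and> w < c \<and> (f ^^ i) c \<in> V w \<and> V b \<subseteq> V w \<and> (f ^^ i) v \<notin> V w"
  using visit_times[OF i]
proof
  assume le: "Suc k * q \<le> i"
  have "(f ^^ (Suc k * q)) v \<in> {x, \<tau> x}"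
    using cascade_boundary_orbit[OF x q cen, of k v k] v by (simp add: b_def cascade_simps(1))
  from lnice_boundary[OF x this, of "i - Suc k * q"] have "(f ^^ i) v \<notin> V x" using le by (simp add: iter_add)
  then show ?thesis using i x x_less_b b_nice V_mono[of x b] lniceD by (intro exI[of _ x]) auto
next
  assume "\<exists>r<k. i = Suc r * q"
  then obtain r where r: "r < k" "i = Suc r * q" by auto
  let ?w = "cascade q x (k - r)"
  have w: "0 \<le> ?w" "?w < c" using cascade_nice[of "k - r"] lniceD by auto
  have "(f ^^ i) v \<in> {?w, \<tau> ?w}"
    using cascade_boundary_orbit[OF x q cen, of k v r] v r by (simp add: b_def)
  then have "(f ^^ i) v \<notin> V ?w" using boundary_outside w by blast
  moreover have "(f ^^ i) c \<in> V ?w" using cascade_orbit[OF x q cen, of k r] r by simp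
  ultimately show ?thesis using w cascade_V[of "k - r" "Suc k"] by (intro exI[of _ ?w]) (auto simp: b_def)
qed

text \<open>An earlier return would come from a point of \<open>V (ret_end q x)\<close> outside
  \<open>V b\<close>. Then \<open>b\<close> lies between its left representative and
  \<open>c\<close>, both sent by \<open>f ^^ q\<close> into \<open>V (cascade q x k)\<close>;
  monotonicity sends \<open>b\<close> there too, although its image is on the boundary.\<close>

lemma return_late: "Suc k * q \<le> q'"
proof (rule ccontr)
  assume n: "\<not> ?thesis"
  have Vbx: "V b \<subseteq> V x" using cascade_V[of 0 "Suc k"] by (simp add: b_def cascade_simps(1))
  then have "(f ^^ q') c \<in> V x" using first_returnD(2)[OF q'] by auto
  then obtain r where r: "r < k" "q' = Suc r * q" using visit_times first_returnD(1)[OF q'] n by blast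
  show False
  proof (cases r)
    case 0
    then show False using r first_returnD(2)[OF q'] out by simp
  next
    case (Suc s)
    let ?y = "(f ^^ (r * q)) c"
    have q0: "0 < q" using first_returnD(1)[OF q] .
    have y01: "?y \<in> {0..1}" using iter_range c01 by simp
    have fy: "(f ^^ q) ?y \<in> V b" using first_returnD(2)[OF q'] r by (simp add: iter_add)
    have "?y \<in> V (cascade q x (k - s))" using cascade_orbit[OF x q cen, of k s] Suc r by simp
    moreover have "V (cascade q x (k - s)) \<subseteq> V (cascade q x 1)" by (rule cascade_V) (use Suc r in auto)
    ultimately have "?y \<in> V (ret_end q x)" by (auto simp: cascade_simps)
    then obtain y' where y': "ret_end q x < y'" "y' \<le> c" "f y' = f ?y"
      using left_representative ret_end_nice[OF x q] lniceD by metis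
    have b0: "0 \<le> b" "b < c" using b_nice lniceD by auto
    have ynb: "?y \<notin> V b" using first_returnD(3)[OF q', of "r * q"] r Suc q0 by auto
    then have yb: "y' \<le> b" using V_iff[OF b0 y01] y' incr[of b y'] b0 by (cases "b < y'") auto
    let ?w = "cascade q x k"
    have w: "0 \<le> ?w" "?w < c" using cascade_nice[of k] lniceD by auto
    have "(f ^^ q) y' \<in> V b" using fy iter_eq[OF y'(3) q0] by simp
    then have "(f ^^ q) y' \<in> V ?w" using cascade_V[of k "Suc k"] by (auto simp: b_def)
    moreover have "(f ^^ q) c \<in> V ?w" using cen by simp
    ultimately have "(f ^^ q) b \<in> V ?w"
      using mono_branch_between[OF first_return_mono_branch[OF x q], of y' b c] y' yb b0
      by (simp add: V_left[OF w])
    then show False using cascade_boundary[OF x q cen, of k] boundary_outside[OF w] by (auto simp: b_def)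
  qed
qed

text \<open>The branch of \<open>f ^^ (q' - 1)\<close> around \<open>f c\<close> is extended as far
  as possible, and only reaching the boundary of \<open>V x\<close> can stop it: stopping at a
  precritical point is excluded by \<open>boundary_separated\<close>.\<close>

lemma branch_extends: "extends_to x b q'"
proof -
  define m where "m = q' - 1"
  have q'0: "0 < q'" using first_returnD(1)[OF q'] .
  have qm: "q' = Suc m" using q'0 by (simp add: m_def)
  have xc: "0 \<le> x" "x < c" using x lniceD by auto
  have b0: "0 \<le> b" "b < c" using b_nice lniceD by auto
  have Vx: "V x = {x<..<\<tau> x}" "x < \<tau> x" "\<tau> x \<le> 1" using V_left tau_left[of x] xc by auto
  have Vbx: "V b \<subseteq> V x" using V_mono[of x b] x_less_b xc b0 by auto
  define y where "y = f c"
  have y01: "y \<in> {0..1}" unfolding y_def using range c01 by simp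
  have fy: "(f ^^ j) y = (f ^^ Suc j) c" for j by (simp add: y_def funpow_swap1)
  \<comment> \<open>The closed set of obstructions: having left \<open>V x\<close> at time
    \<open>m\<close>, or hitting \<open>c\<close> earlier. The branch is the component of the
    complement around \<open>y\<close>.\<close>
  define B where "B = {e \<in> {0..1}. (f ^^ m) e \<notin> V x} \<union> (\<Union>a\<in>{..<m}. {e \<in> {0..1}. (f ^^ a) e = c})"
  have "{e \<in> {0..1}. (f ^^ m) e \<notin> V x} = {0..1} \<inter> (f ^^ m) -` (- V x)" by auto
  moreover have "closed ({0..1} \<inter> (f ^^ m) -` (- V x))"
    by (rule continuous_closed_preimage[OF cont_iter]) (auto simp: Vx closed_def)
  moreover have "closed {e \<in> {0..1}. (f ^^ a) e = c}" for a
    using finite_imp_closed[OF finite_fibre] .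
  ultimately have clB: "closed B" unfolding B_def by (intro closed_Un closed_UN) auto
  have "(f ^^ m) y \<in> V x" unfolding fy using first_returnD(2)[OF q'] Vbx by (auto simp only: qm)
  moreover have "(f ^^ a) y \<noteq> c" for a unfolding fy by (rule crit_orbit_ne) simp
  ultimately have y_notin: "y \<notin> B" unfolding B_def by blast
  have B0: "0 \<in> B" using xc Vx by (auto simp: B_def iter_zero)
  have B1: "1 \<in> B" using xc Vx iter_one[of m] by (cases "m = 0") (auto simp: B_def)
  have branch: "mono_branch m lo hi" if "0 \<le> lo" "lo \<le> hi" "hi \<le> 1" "{lo<..<hi} \<inter> B = {}" for lo hi
  proof -
    have "(f ^^ j) s \<noteq> c" if s: "s \<in> {lo<..<hi}" "j < m" for s j
    proof -
      have "s \<in> {0..1}" "s \<notin> B" using s that(1) \<open>0 \<le> lo\<close> \<open>hi \<le> 1\<close> \<open>{lo<..<hi} \<inter> B = {}\<close> by auto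
      then show ?thesis unfolding B_def using s(2) by blast
    qed
    then show ?thesis unfolding mono_branch_def using that by fastforce
  qed
  \<comment> \<open>If \<open>e\<close> stops the branch only because \<open>f ^^ a\<close> sends it
    to \<open>c\<close>, then \<open>f ^^ a\<close> sends \<open>y\<close> outside
    \<open>V b\<close>, for otherwise \<open>c\<close> would return before \<open>q'\<close>. So
    some \<open>s\<close> between them meets the boundary of \<open>V b\<close>. At time
    \<open>m\<close> both ends are in \<open>V w\<close> but \<open>s\<close> is not, against
    monotonicity.\<close>
  have key: "(f ^^ m) e \<notin> V x"
    if h: "0 \<le> lo" "lo \<le> hi" "hi \<le> 1" "{lo<..<hi} \<inter> B = {}" "{lo, hi} = {e, y}" "e \<in> B" for lo hi e
  proof
    assume eV: "(f ^^ m) e \<in> V x"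
    then obtain a where a: "a < m" "(f ^^ a) e = c" using h(6) by (auto simp: B_def)
    define i where "i = m - a"
    have fi: "(f ^^ m) s = (f ^^ i) ((f ^^ a) s)" for s using a by (simp add: i_def iter_add)
    have i0: "0 < i" using a by (simp add: i_def)
    have ci: "(f ^^ i) c \<in> V x" using eV fi a by simp
    have "(f ^^ a) y \<notin> V b" using first_returnD(3)[OF q', of "Suc a"] a fy qm by simp
    moreover have "(f ^^ a) e \<in> V b" using a c_in_V[OF b0] by simp
    moreover have "(lo = e \<and> hi = y) \<or> (lo = y \<and> hi = e)" using h(5) by (auto simp: doubleton_eq_iff)
    ultimately have "((f ^^ a) lo \<in> V b) \<noteq> ((f ^^ a) hi \<in> V b)" by auto
    then obtain s where s: "s \<in> {lo..hi}" "(f ^^ a) s \<in> {b, \<tau> b}"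
      using crossing[of lo hi "f ^^ a" b] cont_iter'[of "{lo..hi}" a] h b0 by auto
    obtain w where w: "0 \<le> w" "w < c" "(f ^^ i) c \<in> V w" "V b \<subseteq> V w" "(f ^^ i) ((f ^^ a) s) \<notin> V w"
      using boundary_separated[OF i0 ci s(2)] by blast
    have "(f ^^ m) e \<in> V w" "(f ^^ m) y \<in> V w"
      using w fi[of e] a fy[of m] first_returnD(2)[OF q'] qm by auto
    then have "(f ^^ m) lo \<in> V w" "(f ^^ m) hi \<in> V w" using h(5) by (auto simp: doubleton_eq_iff)
    then have "(f ^^ m) s \<in> V w"
      using mono_branch_between[OF branch[OF h(1-4)], of lo s hi w "\<tau> w"] s V_left[OF w(1,2)] by auto
    then show False using w(5) fi by simp
  qed
  define t1 where "t1 = Sup (B \<inter> {0..y})"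
  define t2 where "t2 = Inf (B \<inter> {y..1})"
  have bd: "bdd_above (B \<inter> {0..y})" "bdd_below (B \<inter> {y..1})" by (auto intro: bdd_aboveI bdd_belowI)
  have "t1 \<in> B \<inter> {0..y}" unfolding t1_def
    by (rule closed_contains_Sup) (use B0 y01 clB bd in auto)
  then have t1: "t1 \<in> B" "0 \<le> t1" "t1 < y" using y_notin by (auto simp: less_le)
  have "t2 \<in> B \<inter> {y..1}" unfolding t2_def
    by (rule closed_contains_Inf) (use B1 y01 clB bd in auto)
  then have t2: "t2 \<in> B" "t2 \<le> 1" "y < t2" using y_notin by (auto simp: less_le)
  have n1: "s \<notin> B" if "t1 < s" "s \<le> y" for s
    using cSup_upper[of s "B \<inter> {0..y}"] bd that t1 by (auto simp: t1_def)
  have n2: "s \<notin> B" if "y \<le> s" "s < t2" for s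
    using cInf_lower[of s "B \<inter> {y..1}"] bd that t2 by (auto simp: t2_def)
  have e1: "(f ^^ m) t1 \<notin> V x" by (rule key[of t1 y t1]) (use t1 y01 n1 in auto)
  have e2: "(f ^^ m) t2 \<notin> V x" by (rule key[of y t2 t2]) (use t2 y01 n2 in auto)
  have yV: "(f ^^ m) y \<in> V x" using y_notin y01 by (auto simp: B_def)
  obtain v1 where v1: "v1 \<in> {t1..y}" "(f ^^ m) v1 \<in> {x, \<tau> x}"
    using crossing[of t1 y "f ^^ m" x] cont_iter'[of "{t1..y}" m] e1 yV t1 y01 xc by auto
  have "v1 \<in> B" using v1 t1 y01 boundary_outside[OF xc v1(2)] by (auto simp: B_def)
  then have v1t: "v1 = t1" using n1[of v1] v1 by (auto simp: less_le)
  obtain v2 where v2: "v2 \<in> {y..t2}" "(f ^^ m) v2 \<in> {x, \<tau> x}"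
    using crossing[of y t2 "f ^^ m" x] cont_iter'[of "{y..t2}" m] e2 yV t2 y01 xc by auto
  have "v2 \<in> B" using v2 t2 y01 boundary_outside[OF xc v2(2)] by (auto simp: B_def)
  then have v2t: "v2 = t2" using n2[of v2] v2 by (auto simp: less_le)
  have mb: "mono_branch m t1 t2"
  proof (rule branch)
    show "{t1<..<t2} \<inter> B = {}" using n1 n2 by (metis disjoint_iff greaterThanLessThan_iff linear)
  qed (use t1 t2 in auto)
  have "t1 < t2" using t1 t2 by simp
  then have "(f ^^ m) t1 < (f ^^ m) t2 \<or> (f ^^ m) t2 < (f ^^ m) t1"
    using mono_branch_mono(1)[OF mb] by blast
  then have "(f ^^ m) t1 \<noteq> (f ^^ m) t2" by auto
  then have ends: "{(f ^^ m) t1, (f ^^ m) t2} = {x, \<tau> x}" using v1 v2 v1t v2t by auto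
  \<comment> \<open>Otherwise \<open>b\<close> is in \<open>V x\<close> at time \<open>q'\<close>,
    although by \<open>return_late\<close> it has already touched the boundary of
    \<open>V x\<close>.\<close>
  have "f b \<le> t1"
  proof (rule ccontr)
    assume "\<not> ?thesis"
    then have "f b \<notin> B" using n1[of "f b"] incr[of b c] b0 by (simp add: y_def)
    then have "(f ^^ m) (f b) \<in> V x" using range[of b] b0 c01 by (auto simp: B_def)
    then have "(f ^^ q') b \<in> V x" by (simp add: qm funpow_swap1)
    moreover have "(f ^^ (Suc k * q)) b \<in> {x, \<tau> x}"
      using cascade_boundary_orbit[OF x q cen, of k b k] by (simp add: b_def cascade_simps(1))
    then have "(f ^^ (q' - Suc k * q)) ((f ^^ (Suc k * q)) b) \<notin> V x" by (rule lnice_boundary[OF x])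
    ultimately show False using return_late by (simp add: iter_add)
  qed
  then show ?thesis unfolding extends_to_def m_def[symmetric] using mb t1 t2 ends
    by (intro exI[of _ t1] exI[of _ t2]) (auto simp: y_def)
qed

lemma return_increases: "q < q'"
proof -
  have "q \<le> q'" using return_late by simp
  moreover have "q \<noteq> q'" using out first_returnD(2)[OF q'] by auto
  ultimately show ?thesis by simp
qed

lemma first_return_on_b:
  assumes "y \<in> V b"
  shows "(f ^^ q) y \<in> V x"
proof -
  have "(f ^^ q) y \<in> V (cascade q x k)"
    by (rule cascade_inside[OF x q cen]) (use assms b_def in auto)
  then show ?thesis using cascade_V[of 0 k] by (auto simp: cascade_simps)
qed

lemma first_return_of_b: "(f ^^ q) b \<in> {x..\<tau> x}"
proof -
  have "x \<le> cascade q x k" using cascade_le[of 0 k] by (simp add: cascade_simps(1))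
  then show ?thesis
    using cascade_boundary[OF x q cen, of k] cascade_nice[of k] lniceD tau_mono[of x "cascade q x k"]
      tau_left(1)[of x] tau_left(1)[of "cascade q x k"] x by (force simp: b_def)
qed

end

end

section \<open>Koebe space\<close>

text \<open>The denominator is the product of the side gaps plus the numerator, so a cross-ratio
  bounded away from 1 is the same as definite space around the middle interval.\<close>

lemma cross_ratio_le_iff:
  assumes "w < p" "p < r" "r < z" "\<kappa> > 0"
  shows "cross_ratio w p r z \<le> 1 / (1 + \<kappa>) \<longleftrightarrow> \<kappa> * ((r - p) * (z - w)) \<le> (p - w) * (z - r)"
proof -
  have e: "(r - w) * (z - p) = (p - w) * (z - r) + (r - p) * (z - w)" by (simp add: algebra_simps)
  have "0 < (p - w) * (z - r) + (r - p) * (z - w)" using assms by (intro add_pos_pos mult_pos_pos) auto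
  moreover have "A / B \<le> 1 / (1 + \<kappa>) \<longleftrightarrow> A * (1 + \<kappa>) \<le> B" if "B > 0" for A B :: real
    using that assms by (simp add: field_simps)
  ultimately show ?thesis unfolding cross_ratio_def e by (simp add: algebra_simps)
qed

context unimodal begin

text \<open>Cross-ratio expansion under \<open>f ^^ (q - 1)\<close> is applied to \<open>t1\<close>,
  \<open>f z\<close>, \<open>f c\<close>, \<open>t2\<close>: space around {u..v} inside
  \<open>V x\<close> pulls back to space around the interval from \<open>f z\<close> to
  \<open>f c\<close>.\<close>

lemma koebe_space:
  assumes ext: "extends_to x b q" and q: "0 < q" and b: "0 \<le> b" "b \<le> z" "z < c" and x: "0 \<le> x" "x < c"
    and img: "\<And>y. z \<le> y \<Longrightarrow> y \<le> c \<Longrightarrow> (f ^^ q) y \<in> {u..v}"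
    and uv: "x < u" "v < \<tau> x" and \<kappa>: "\<kappa> > 0" "\<kappa> * ((v - u) * (\<tau> x - x)) \<le> (u - x) * (\<tau> x - v)"
  shows "(1 + \<kappa>) * (f c - f z) \<le> f c - f b"
proof -
  obtain t1 t2 where t: "mono_branch (q - 1) t1 t2" "t1 < f c" "f c < t2" "f b \<le> t1"
    "{(f ^^ (q - 1)) t1, (f ^^ (q - 1)) t2} = {x, \<tau> x}"
    using ext unfolding extends_to_def by blast
  let ?g = "f ^^ (q - 1)"
  have g: "?g (f y) = (f ^^ q) y" for y using q by (cases q) (auto simp: funpow_swap1)
  have cz: "f z < f c" using incr[of z c] b by simp
  have "t1 < f z"
  proof (rule ccontr)
    assume "\<not> ?thesis"
    then obtain y where y: "z \<le> y" "y \<le> c" "f y = t1"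
      using IVT'[of f z t1 c] continuous_on_subset[OF cont_f, of "{z..c}"] b c01 t by auto
    then have "?g t1 \<in> {u..v}" using img[of y] g[of y] by simp
    moreover have "?g t1 \<in> {x, \<tau> x}" using t(5) by auto
    ultimately show False using uv by auto
  qed
  have A: "?g (f z) \<in> {u..v}" "?g (f c) \<in> {u..v}" using g img[of z] img[of c] b by auto
  have x_tau: "x < \<tau> x" using tau_left(1)[OF x] x by simp
  have bound: "cross_ratio x p r (\<tau> x) \<le> 1 / (1 + \<kappa>)" if "p \<in> {u..v}" "r \<in> {u..v}" "p < r" for p r
  proof -
    have "\<kappa> * ((r - p) * (\<tau> x - x)) \<le> \<kappa> * ((v - u) * (\<tau> x - x))"
      using that \<kappa> x_tau by (intro mult_left_mono mult_right_mono) auto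
    also have "\<dots> \<le> (u - x) * (\<tau> x - v)" by (rule \<kappa>(2))
    also have "\<dots> \<le> (p - x) * (\<tau> x - r)" using that uv by (intro mult_mono) auto
    finally show ?thesis using cross_ratio_le_iff[of x p r "\<tau> x" \<kappa>] that uv \<kappa> by auto
  qed
  have "cross_ratio t1 (f z) (f c) t2 \<le> cross_ratio (?g t1) (?g (f z)) (?g (f c)) (?g t2)"
    using mono_branch_mono(2)[OF t(1), of t1 "f z" "f c" t2] t \<open>t1 < f z\<close> cz by simp
  also have "\<dots> \<le> 1 / (1 + \<kappa>)"
    using mono_branch_mono(1)[OF t(1)]
  proof
    assume m: "\<forall>x y. t1 \<le> x \<and> x < y \<and> y \<le> t2 \<longrightarrow> ?g x < ?g y"
    have "?g t1 < ?g t2" "?g (f z) < ?g (f c)" using m t \<open>t1 < f z\<close> cz by auto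
    then have "?g t1 = x" "?g t2 = \<tau> x" using t(5) x_tau by (auto simp: doubleton_eq_iff)
    then show ?thesis using bound A \<open>?g (f z) < ?g (f c)\<close> by simp
  next
    assume m: "\<forall>x y. t1 \<le> x \<and> x < y \<and> y \<le> t2 \<longrightarrow> ?g y < ?g x"
    have "?g t2 < ?g t1" "?g (f c) < ?g (f z)" using m t \<open>t1 < f z\<close> cz by auto
    then have "?g t2 = x" "?g t1 = \<tau> x" using t(5) x_tau by (auto simp: doubleton_eq_iff)
    then show ?thesis using bound[of "?g (f c)" "?g (f z)"] A \<open>?g (f c) < ?g (f z)\<close>
      by (simp add: cross_ratio_rev[of "\<tau> x"])
  qed
  finally have le: "\<kappa> * ((f c - f z) * (t2 - t1)) \<le> (f z - t1) * (t2 - f c)"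
    using cross_ratio_le_iff[of t1 "f z" "f c" t2 \<kappa>] t \<open>t1 < f z\<close> cz \<kappa> by simp
  \<comment> \<open>The gap above \<open>f c\<close> is bounded by the whole branch, which cancels.
    All the space is thus below \<open>f z\<close>, on the side that \<open>f\<close> pulls back to
    both sides of \<open>c\<close>.\<close>
  also have "\<dots> \<le> (f z - t1) * (t2 - t1)" using t \<open>t1 < f z\<close> by (intro mult_left_mono) auto
  finally have "(\<kappa> * (f c - f z)) * (t2 - t1) \<le> (f z - t1) * (t2 - t1)" by (simp only: mult.assoc)
  then have "\<kappa> * (f c - f z) \<le> f z - t1" using t by (simp add: mult_le_cancel_right)
  then show ?thesis using t(4) by (simp add: algebra_simps)
qed

end

text \<open>Non-flatness enters only through the coordinate \<open>\<alpha> = \<bar>\<phi>\<bar>\<close>: it is bi-Lipschitz on each side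
  of the critical point and symmetric under \<open>\<tau>\<close>.\<close>

locale critical_coordinate = recurrent_unimodal +
  fixes l K e :: real and \<alpha> :: "real \<Rightarrow> real"
  assumes l: "0 < l" and K: "1 \<le> K" and e: "0 < e" "0 < c - e" "c + e < 1"
    and \<alpha>_nonneg: "\<And>x. x \<in> {c - e..c + e} \<Longrightarrow> 0 \<le> \<alpha> x"
    and f_\<alpha>: "\<And>x. x \<in> {c - e..c + e} \<Longrightarrow> f x = f c - \<alpha> x powr l"
    and \<alpha>_c: "\<alpha> c = 0"
    and \<alpha>_left: "\<And>x y. c - e \<le> x \<Longrightarrow> x \<le> y \<Longrightarrow> y \<le> c \<Longrightarrow> y - x \<le> K * (\<alpha> x - \<alpha> y) \<and> \<alpha> x - \<alpha> y \<le> K * (y - x)"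
    and \<alpha>_right: "\<And>x y. c \<le> x \<Longrightarrow> x \<le> y \<Longrightarrow> y \<le> c + e \<Longrightarrow> y - x \<le> K * (\<alpha> y - \<alpha> x) \<and> \<alpha> y - \<alpha> x \<le> K * (y - x)"

lemma (in recurrent_unimodal) critical_coordinate_exists:
  "\<exists>l K e \<alpha>. critical_coordinate f c l K e \<alpha>"
proof -
  obtain l e \<phi> g1 g2 g3 where C3: "C3_derivs {c-e..c+e} \<phi> g1 g2 g3"
    and f\<phi>: "\<forall>x\<in>{c-e..c+e}. f x = f c - \<bar>\<phi> x\<bar> powr l"
    and nz: "\<forall>x\<in>{c-e..c+e}. g1 x \<noteq> 0" and \<phi>c: "\<phi> c = 0"
    and l: "l > 1" and e: "e > 0" "0 < c - e" "c + e < 1"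
    using S unfolding S_unimodal_def by (elim conjE exE) (rule that, assumption+)
  have ct: "continuous_on {c-e..c+e} g1"
    using C3 unfolding C3_derivs_def continuous_on_eq_continuous_within by (meson DERIV_continuous)
  have cn: "connected (g1 ` {c-e..c+e})" by (intro connected_continuous_image ct connected_Icc)
  have "\<exists>s\<in>{-1, 1::real}. \<forall>x\<in>{c-e..c+e}. s * g1 x > 0"
  proof (rule ccontr)
    assume "\<not> ?thesis"
    then obtain x y where xy: "x \<in> {c-e..c+e}" "y \<in> {c-e..c+e}" "g1 x \<ge> 0" "g1 y \<le> 0"
      by (auto simp: not_less)
    then have "0 \<in> g1 ` {c-e..c+e}" using connectedD_interval[OF cn, of "g1 y" "g1 x" 0] by blast
    then show False using nz by force
  qed
  then obtain s where s: "s = -1 \<or> s = (1::real)" "\<And>x. x \<in> {c-e..c+e} \<Longrightarrow> s * g1 x > 0" by blast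
  have cts: "continuous_on {c-e..c+e} (\<lambda>x. s * g1 x)" by (intro continuous_intros ct)
  have cne: "compact {c-e..c+e}" "{c-e..c+e} \<noteq> {}" using e by auto
  obtain x0 where x0: "x0 \<in> {c-e..c+e}" "\<And>x. x \<in> {c-e..c+e} \<Longrightarrow> s * g1 x0 \<le> s * g1 x"
    using continuous_attains_inf[OF cne cts] by blast
  obtain x1 where x1: "x1 \<in> {c-e..c+e}" "\<And>x. x \<in> {c-e..c+e} \<Longrightarrow> s * g1 x \<le> s * g1 x1"
    using continuous_attains_sup[OF cne cts] by blast
  \<comment> \<open>With \<open>s\<close> the sign of the derivative of the local diffeomorphism,
    \<open>K\<close> dominates both the largest slope and the inverse of the smallest one.\<close>
  define K where "K = max 1 (max (s * g1 x1) (1 / (s * g1 x0)))"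
  have K1: "K \<ge> 1" by (simp add: K_def)
  have bnd: "1 \<le> K * (s * g1 x)" "s * g1 x \<le> K" if "x \<in> {c-e..c+e}" for x
  proof -
    have "1 / (s * g1 x0) * (s * g1 x0) \<le> K * (s * g1 x)"
      by (rule mult_mono) (use x0(2)[OF that] s(2)[OF x0(1)] K1 in \<open>simp_all add: K_def\<close>)
    then show "1 \<le> K * (s * g1 x)" using s(2)[OF x0(1)] by (auto split: if_splits)
    show "s * g1 x \<le> K" using x1(2)[OF that] by (simp add: K_def)
  qed
  have mv: "y - x \<le> K * (s * \<phi> y - s * \<phi> x) \<and> s * \<phi> y - s * \<phi> x \<le> K * (y - x)"
    if xy: "c - e \<le> x" "x \<le> y" "y \<le> c + e" for x y
  proof -
    have "(\<phi> has_derivative (\<lambda>h. g1 t * h)) (at t within {x..y})" if "x \<le> t" "t \<le> y" for t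
      using C3 that xy has_derivative_subset[of \<phi> _ t "{c-e..c+e}" "{x..y}"]
      unfolding C3_derivs_def has_field_derivative_def by auto
    then obtain t where t: "t \<in> {x..y}" "\<phi> y - \<phi> x = g1 t * (y - x)"
      using mvt_very_simple[OF xy(2), of \<phi> "\<lambda>t h. g1 t * h"] by blast
    have eq: "s * \<phi> y - s * \<phi> x = (s * g1 t) * (y - x)" using t(2) by (simp flip: right_diff_distrib)
    have tt: "t \<in> {c-e..c+e}" using t xy by auto
    have "1 * (y - x) \<le> (K * (s * g1 t)) * (y - x)" using bnd(1)[OF tt] xy by (intro mult_right_mono) auto
    moreover have "(s * g1 t) * (y - x) \<le> K * (y - x)" using bnd(2)[OF tt] xy by (intro mult_right_mono) auto
    ultimately show ?thesis unfolding eq by (simp add: mult.assoc)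
  qed
  have abs_left: "\<bar>\<phi> x\<bar> = - (s * \<phi> x)" if "c - e \<le> x" "x \<le> c" for x
  proof -
    have "0 \<le> K * (- (s * \<phi> x))" using mv[of x c] that e \<phi>c by auto
    then have "0 \<le> - (s * \<phi> x)" using K1 by (auto simp: zero_le_mult_iff mult_le_0_iff)
    then show ?thesis using s(1) by auto
  qed
  have abs_right: "\<bar>\<phi> x\<bar> = s * \<phi> x" if "c \<le> x" "x \<le> c + e" for x
  proof -
    have "0 \<le> K * (s * \<phi> x)" using mv[of c x] that e \<phi>c by auto
    then have "0 \<le> s * \<phi> x" using K1 by (auto simp: zero_le_mult_iff mult_le_0_iff)
    then show ?thesis using s(1) by auto
  qed
  have "critical_coordinate f c l K e (\<lambda>x. \<bar>\<phi> x\<bar>)"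
  proof unfold_locales
    fix x y assume "c - e \<le> x" "x \<le> y" "y \<le> c"
    then show "y - x \<le> K * (\<bar>\<phi> x\<bar> - \<bar>\<phi> y\<bar>) \<and> \<bar>\<phi> x\<bar> - \<bar>\<phi> y\<bar> \<le> K * (y - x)"
      using mv[of x y] abs_left[of x] abs_left[of y] e by (auto simp: algebra_simps)
  next
    fix x y assume "c \<le> x" "x \<le> y" "y \<le> c + e"
    then show "y - x \<le> K * (\<bar>\<phi> y\<bar> - \<bar>\<phi> x\<bar>) \<and> \<bar>\<phi> y\<bar> - \<bar>\<phi> x\<bar> \<le> K * (y - x)"
      using mv[of x y] abs_right[of x] abs_right[of y] e by auto
  next
    fix x assume "x \<in> {c - e..c + e}"
    then show "f x = f c - \<bar>\<phi> x\<bar> powr l" using f\<phi> by blast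
  qed (use l K1 e \<phi>c in auto)
  then show ?thesis by blast
qed

context critical_coordinate begin

lemma K_pos: "0 < K"
  using K by simp

text \<open>Both endpoints must lie where the estimates for \<open>\<alpha>\<close> hold, since gaps
  are measured on either side of \<open>c\<close>.\<close>

definition near :: "real \<Rightarrow> bool" where
  "near x \<longleftrightarrow> c - e \<le> x \<and> x < c \<and> \<tau> x \<le> c + e"

lemma nearD:
  assumes "near x"
  shows "0 \<le> x" "x < c" "c - e \<le> x" "c < \<tau> x" "\<tau> x \<le> c + e" "x \<in> {c - e..c + e}" "\<tau> x \<in> {c - e..c + e}" "f (\<tau> x) = f x"
  using assms e tau_left[of x] by (auto simp: near_def)

lemma near_mono:
  assumes "near x" "x \<le> y" "y < c"
  shows "near y"
  unfolding near_def using nearD(3,5)[OF assms(1)] tau_mono[OF nearD(1)[OF assms(1)] assms(2,3)] assms(2,3)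
  by simp

lemma \<alpha>_eq:
  assumes "x \<in> {c - e..c + e}"
  shows "\<alpha> x = (f c - f x) powr (1 / l)"
proof -
  have "f c - f x = \<alpha> x powr l" using f_\<alpha>[OF assms] by linarith
  then show ?thesis using \<alpha>_nonneg[OF assms] l by (simp add: powr_powr)
qed

lemma \<alpha>_tau: "near x \<Longrightarrow> \<alpha> (\<tau> x) = \<alpha> x"
  using nearD[of x] by (simp add: \<alpha>_eq)

lemma left_bounds:
  assumes "near x" "x \<le> y" "y < c"
  shows "y - x \<le> K * (\<alpha> x - \<alpha> y)" "\<alpha> x - \<alpha> y \<le> K * (y - x)"
  using \<alpha>_left[of x y] nearD[OF assms(1)] assms by auto

lemma right_bounds:
  assumes "near x" "x \<le> y" "y < c"
  shows "\<tau> x - \<tau> y \<le> K * (\<alpha> x - \<alpha> y)" "\<alpha> x - \<alpha> y \<le> K * (\<tau> x - \<tau> y)"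
  using \<alpha>_right[of "\<tau> y" "\<tau> x"] nearD[OF assms(1)] nearD[OF near_mono[OF assms]] tau_mono[of x y] assms \<alpha>_tau near_mono[OF assms]
  by auto

lemma center_bounds:
  assumes "near x"
  shows "c - x \<le> K * \<alpha> x" "\<alpha> x \<le> K * (c - x)" "\<tau> x - c \<le> K * \<alpha> x" "\<alpha> x \<le> K * (\<tau> x - c)"
  using \<alpha>_left[of x c] \<alpha>_right[of c "\<tau> x"] nearD[OF assms] \<alpha>_c \<alpha>_tau[OF assms] e by auto

lemma \<alpha>_pos: "near x \<Longrightarrow> 0 < \<alpha> x"
proof -
  assume x: "near x"
  have "0 < K * \<alpha> x" using center_bounds(1)[OF x] nearD[OF x] by linarith
  then show ?thesis using K_pos by (simp add: zero_less_mult_iff)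
qed

text \<open>A factor between depths below \<open>f c\<close> becomes its root of order
  \<open>l\<close> in the coordinate.\<close>

lemma \<alpha>_expand:
  assumes "near x" "near z" "0 < \<kappa>" "(1 + \<kappa>) * (f c - f z) \<le> f c - f x"
  shows "(1 + \<kappa>) powr (1 / l) * \<alpha> z \<le> \<alpha> x"
proof -
  have fz: "0 \<le> f c - f z" using f_\<alpha>[of z] nearD[OF assms(2)] by simp
  have "((1 + \<kappa>) * (f c - f z)) powr (1 / l) \<le> (f c - f x) powr (1 / l)"
    using assms fz l by (intro powr_mono2) auto
  then show ?thesis using \<alpha>_eq nearD assms fz by (simp add: powr_mult)
qed

lemma ilen_V: "0 \<le> x \<Longrightarrow> x < c \<Longrightarrow> ilen (V x) = \<tau> x - x"
  using V_left[of x] tau_left(1)[of x] by (simp add: ilen_def)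

lemma ilen_V_le: "near x \<Longrightarrow> ilen (V x) \<le> 2 * K * \<alpha> x"
  using center_bounds[of x] ilen_V nearD[of x] by auto

text \<open>The central domain has length at most 2 K times the coordinate of its endpoint, and each
  gap is at least 1/K times the difference of coordinates; hence the factor 2 K^2.\<close>

lemma transfer_range_of_expansion:
  assumes b: "lnice b" "near b" and q: "first_return q b" and r: "1 < r" "r * \<alpha> (ret_end q b) \<le> \<alpha> b"
    and \<delta>: "0 < \<delta>" "\<delta> * (2 * K\<^sup>2) \<le> r - 1"
  shows "transfer_range f c \<delta> b"
proof -
  let ?z = "ret_end q b"
  note R = ret_end[OF b(1) first_returnD(2)[OF q]]
  have z: "near ?z" by (rule near_mono[OF b(2) R(1,2)])
  note nb = nearD[OF b(2)] and nz = nearD[OF z]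
  have "\<delta> * ilen (V ?z) \<le> \<delta> * (2 * K * \<alpha> ?z)" using ilen_V_le[OF z] \<delta> by (intro mult_left_mono) auto
  then have "K * (\<delta> * ilen (V ?z)) \<le> K * (\<delta> * (2 * K * \<alpha> ?z))"
    by (rule mult_left_mono) (use K_pos in simp)
  also have "\<dots> = (\<delta> * (2 * K\<^sup>2)) * \<alpha> ?z" by (simp add: power2_eq_square)
  also have "\<dots> \<le> (r - 1) * \<alpha> ?z" using \<delta>(2) \<alpha>_pos[OF z] by (intro mult_right_mono) auto
  also have "\<dots> \<le> \<alpha> b - \<alpha> ?z" using r by (simp add: algebra_simps)
  finally have s: "K * (\<delta> * ilen (V ?z)) \<le> \<alpha> b - \<alpha> ?z" .
  have "K * (\<delta> * ilen (V ?z)) \<le> K * (?z - b)" using s left_bounds(2)[OF b(2) R(1,2)] by simp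
  then have 1: "\<delta> * ilen (V ?z) \<le> ?z - b" using K_pos by simp
  have "K * (\<delta> * ilen (V ?z)) \<le> K * (\<tau> b - \<tau> ?z)" using s right_bounds(2)[OF b(2) R(1,2)] by simp
  then have 2: "\<delta> * ilen (V ?z) \<le> \<tau> b - \<tau> ?z" using K_pos by simp
  have "V ?z \<subseteq> V b" using V_mono R nb by auto
  then have "scaled_nbhd \<delta> (V ?z) (V b)"
    unfolding scaled_nbhd_def using 1 2 c_in_V[of ?z] V_left[of ?z] V_left[of b] nb nz by auto
  then show ?thesis unfolding transfer_range_def Uint_ret_end[OF b(1) q] using lnice_nice b by simp
qed

text \<open>The values are forced by \<open>transfer_range_step\<close>. For
  \<open>\<kappa>1\<close>: image times total length is at most 2 K^2 times gap times
  \<open>\<alpha> x'\<close>, while the product of the two side spaces is at least that gap times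
  \<open>\<alpha> x'\<close> over K^2. For \<open>\<kappa>2\<close>: the lengths of
  \<open>V b\<close> and \<open>V x\<close> are at most 2 K times \<open>\<alpha> x\<close>, and
  both side spaces are at least (1 - 1/\<sigma>) times \<open>\<alpha> x\<close> over K.
  \<open>\<rho>\<close> takes the worse of the two cases.\<close>

definition \<kappa>1 :: real where "\<kappa>1 = 1 / (2 * K ^ 4)"
text \<open>A square root, so that the expansion from Z to A_n splits into two equal factors, one on
  either side of A_(n+1).\<close>

definition \<sigma> :: real where "\<sigma> = sqrt ((1 + \<kappa>1) powr (1 / l))"
definition \<kappa>2 :: real where "\<kappa>2 = (1 - 1 / \<sigma>)\<^sup>2 / (4 * K ^ 4)"
definition \<rho> :: real where "\<rho> = min \<sigma> ((1 + \<kappa>2) powr (1 / l))"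
definition \<delta> :: real where "\<delta> = (\<rho> - 1) / (2 * K\<^sup>2)"

lemma constants: "0 < \<kappa>1" "1 < \<sigma>" "0 < \<kappa>2" "1 < \<rho>" "0 < \<delta>" "\<sigma> * \<sigma> = (1 + \<kappa>1) powr (1 / l)"
proof -
  show k1: "0 < \<kappa>1" using K_pos by (simp add: \<kappa>1_def)
  have "1 < (1 + \<kappa>1) powr (1 / l)" using k1 l by (simp add: gr_one_powr)
  then show s: "1 < \<sigma>" by (simp add: \<sigma>_def)
  then show k2: "0 < \<kappa>2" using K_pos by (simp add: \<kappa>2_def)
  show rho: "1 < \<rho>" using s k2 l by (simp add: \<rho>_def gr_one_powr)
  then show "0 < \<delta>" using K_pos by (simp add: \<delta>_def)
  show "\<sigma> * \<sigma> = (1 + \<kappa>1) powr (1 / l)" by (simp add: \<sigma>_def)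
qed

text \<open>Here \<open>x'\<close>, \<open>x\<close>, \<open>b\<close> are the left endpoints of
  A_(n-1), A_n, A_(n+1), and \<open>gap\<close> is the comparison available at infinitely many
  levels.\<close>

lemma transfer_range_step:
  assumes x': "near x'" "x' < x" and x: "lnice x" "x < b" and b: "lnice b"
    and q: "first_return q x" "(f ^^ q) c \<notin> V b" "extends_to x' x q"
    and qb: "\<And>y. y \<in> V b \<Longrightarrow> (f ^^ q) y \<in> V x" "(f ^^ q) b \<in> {x..\<tau> x}"
    and q': "first_return q' b" "extends_to x b q'" "q < q'"
    and gap: "\<alpha> x - \<alpha> b \<le> \<alpha> x' - \<alpha> x"
  shows "transfer_range f c \<delta> b"
proof -
  let ?z = "ret_end q' b"
  note R = ret_end[OF b first_returnD(2)[OF q'(1)]]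
  have bc: "0 \<le> b" "b < c" and xc: "0 \<le> x" "x < c" using b x lniceD by auto
  have nx: "near x" using near_mono[OF x'(1)] x' xc by simp
  have nb: "near b" using near_mono[OF nx] x bc by simp
  have nz: "near ?z" by (rule near_mono[OF nb R(1,2)])
  note Nx' = nearD[OF x'(1)] and Nx = nearD[OF nx] and Nb = nearD[OF nb] and Nz = nearD[OF nz]
  have tt: "\<tau> x < \<tau> x'" "\<tau> b < \<tau> x" using tau_strict x' x Nx' Nx Nb by auto
  have q0: "0 < q" using first_returnD(1)[OF q(1)] .
  have Vb: "V b = {b<..<\<tau> b}" using V_left bc by simp
  have Vx: "V x = {x<..<\<tau> x}" using V_left xc by simp
  \<comment> \<open>Points of Z first return to \<open>V b\<close> at time \<open>q'\<close>, and
    \<open>q < q'\<close>, so at time \<open>q\<close> they are still outside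
    \<open>V b\<close>.\<close>
  have img: "(f ^^ q) y \<in> {x..\<tau> x} \<and> (f ^^ q) y \<notin> V b" if y: "?z \<le> y" "y \<le> c" for y
  proof (cases "y = ?z")
    case True
    have "(f ^^ q) ?z \<in> {x..\<tau> x}"
    proof (cases "?z = b")
      case True
      then show ?thesis using qb(2) by simp
    next
      case False
      then have "?z \<in> V b" using Vb R(1,2) Nb by auto
      then show ?thesis using qb(1)[of ?z] Vx by auto
    qed
    then show ?thesis using True ret_end_orbit[OF b q'(1) q0] by simp
  next
    case False
    then have "y \<in> V ?z" using y V_left Nz by auto
    moreover then have "y \<in> V b" using V_mono[OF bc(1) R(1,2)] by auto
    ultimately show ?thesis using qb(1)[of y] Vx ret_end_avoids[OF b q'(1) _ q0 q'(3)] by auto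
  qed
  \<comment> \<open>The image is connected and misses \<open>c\<close>, hence lies in one component
    of the gap.\<close>
  have side: "(\<forall>y. ?z \<le> y \<and> y \<le> c \<longrightarrow> (f ^^ q) y \<in> {x..b}) \<or> (\<forall>y. ?z \<le> y \<and> y \<le> c \<longrightarrow> (f ^^ q) y \<in> {\<tau> b..\<tau> x})"
  proof (rule ccontr)
    assume "\<not> ?thesis"
    then obtain y1 y2 where y: "?z \<le> y1" "y1 \<le> c" "(f ^^ q) y1 \<notin> {x..b}" "?z \<le> y2" "y2 \<le> c" "(f ^^ q) y2 \<notin> {\<tau> b..\<tau> x}"
      by blast
    have v: "(f ^^ q) y2 \<le> b" "\<tau> b \<le> (f ^^ q) y1" using img[of y1] img[of y2] y Vb by auto
    have cn: "connected ((f ^^ q) ` {?z..c})"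
      by (intro connected_continuous_image connected_Icc cont_iter') (use Nz c01 in auto)
    have "c \<in> (f ^^ q) ` {?z..c}"
      using connectedD_interval[OF cn, of "(f ^^ q) y2" "(f ^^ q) y1" c] v y Nb by auto
    then show False using img c_in_V[OF bc] by auto
  qed
  define a where "a = \<alpha> x' - \<alpha> x"
  have a: "x - x' \<le> K * a" "a \<le> K * (x - x')" "a \<le> K * (\<tau> x' - \<tau> x)" "b - x \<le> K * a" "\<tau> x - \<tau> b \<le> K * a"
  proof -
    show "x - x' \<le> K * a" "a \<le> K * (x - x')" "a \<le> K * (\<tau> x' - \<tau> x)"
      using left_bounds[OF x'(1), of x] right_bounds[OF x'(1), of x] x' xc by (auto simp: a_def)
    have "K * (\<alpha> x - \<alpha> b) \<le> K * a" unfolding a_def using gap K_pos by (intro mult_left_mono) auto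
    then show "b - x \<le> K * a" "\<tau> x - \<tau> b \<le> K * a"
      using left_bounds(1)[OF nx, of b] right_bounds(1)[OF nx, of b] x bc by auto
  qed
  have a0: "0 < a"
  proof -
    have "0 < K * a" using a(1) x' by linarith
    then show ?thesis using K_pos by (simp add: zero_less_mult_iff)
  qed
  have ax': "0 < \<alpha> x'" using \<alpha>_pos x' by simp
  have K4: "\<kappa>1 * ((K * a) * (2 * K * \<alpha> x')) * K\<^sup>2 = a * \<alpha> x'"
    unfolding \<kappa>1_def using K_pos by (simp add: field_simps power2_eq_square power4_eq_xxxx)
  \<comment> \<open>One formulation for both sides: the near space is at least \<open>a / K\<close>,
    the far one at least \<open>\<alpha> x' / K\<close>.\<close>
  have space: "\<kappa>1 * ((v - u) * (\<tau> x' - x')) \<le> (u - x') * (\<tau> x' - v)"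
    if uv: "u \<le> v" "v - u \<le> K * a" and w: "(a \<le> K * (u - x') \<and> \<alpha> x' \<le> K * (\<tau> x' - v)) \<or> (\<alpha> x' \<le> K * (u - x') \<and> a \<le> K * (\<tau> x' - v))"
    for u v
  proof -
    have "(v - u) * (\<tau> x' - x') \<le> (K * a) * (2 * K * \<alpha> x')"
      using uv ilen_V_le[OF x'(1)] ilen_V Nx' a0 K_pos by (intro mult_mono) auto
    then have "\<kappa>1 * ((v - u) * (\<tau> x' - x')) \<le> \<kappa>1 * ((K * a) * (2 * K * \<alpha> x'))"
      using constants(1) by (intro mult_left_mono) auto
    then have "\<kappa>1 * ((v - u) * (\<tau> x' - x')) * K\<^sup>2 \<le> \<kappa>1 * ((K * a) * (2 * K * \<alpha> x')) * K\<^sup>2"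
      by (intro mult_right_mono) auto
    also have "\<dots> = a * \<alpha> x'" by (rule K4)
    also have "\<dots> \<le> (K * (u - x')) * (K * (\<tau> x' - v))"
      using w
    proof
      assume "a \<le> K * (u - x') \<and> \<alpha> x' \<le> K * (\<tau> x' - v)"
      then show ?thesis using a0 ax' by (intro mult_mono) auto
    next
      assume "\<alpha> x' \<le> K * (u - x') \<and> a \<le> K * (\<tau> x' - v)"
      then have "\<alpha> x' * a \<le> (K * (u - x')) * (K * (\<tau> x' - v))" using a0 ax' by (intro mult_mono) auto
      then show ?thesis by (simp add: mult.commute)
    qed
    also have "\<dots> = (u - x') * (\<tau> x' - v) * K\<^sup>2" by (simp add: power2_eq_square)
    finally show ?thesis using K_pos by (simp add: mult_le_cancel_right)
  qed
  have "(1 + \<kappa>1) * (f c - f ?z) \<le> f c - f x"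
    using side
  proof
    assume i: "\<forall>y. ?z \<le> y \<and> y \<le> c \<longrightarrow> (f ^^ q) y \<in> {x..b}"
    have "K * (\<tau> x' - c) \<le> K * (\<tau> x' - b)" using K_pos bc by (intro mult_left_mono) auto
    then have "\<alpha> x' \<le> K * (\<tau> x' - b)" using center_bounds(4)[OF x'(1)] by simp
    then have "\<kappa>1 * ((b - x) * (\<tau> x' - x')) \<le> (x - x') * (\<tau> x' - b)"
      using space[of x b] a x by auto
    then show ?thesis
      using koebe_space[OF q(3) q0, of ?z x b \<kappa>1] i R(1,2) x x' xc Nx' Nb constants(1) by auto
  next
    assume i: "\<forall>y. ?z \<le> y \<and> y \<le> c \<longrightarrow> (f ^^ q) y \<in> {\<tau> b..\<tau> x}"
    have "K * (c - x') \<le> K * (\<tau> b - x')" using K_pos Nb by (intro mult_left_mono) auto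
    then have "\<alpha> x' \<le> K * (\<tau> b - x')" using center_bounds(2)[OF x'(1)] by simp
    then have "\<kappa>1 * ((\<tau> x - \<tau> b) * (\<tau> x' - x')) \<le> (\<tau> b - x') * (\<tau> x' - \<tau> x)"
      using space[of "\<tau> b" "\<tau> x"] a tt by auto
    then show ?thesis
      using koebe_space[OF q(3) q0, of ?z "\<tau> b" "\<tau> x" \<kappa>1] i R(1,2) x x' xc Nx' Nb tt constants(1) by auto
  qed
  then have exp1: "\<sigma> * \<sigma> * \<alpha> ?z \<le> \<alpha> x"
    using \<alpha>_expand[OF nx nz constants(1)] constants(6) by simp
  \<comment> \<open>Of the total factor \<open>\<sigma> * \<sigma>\<close> between Z and A_n, either
    a factor \<open>\<sigma>\<close> lies between Z and A_(n+1), or at least \<open>\<sigma>\<close>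
    lies between A_(n+1) and A_n and feeds the second cross-ratio estimate.\<close>
  have "\<rho> * \<alpha> ?z \<le> \<alpha> b"
  proof (cases "\<sigma> * \<alpha> ?z \<le> \<alpha> b")
    case True
    have "\<rho> * \<alpha> ?z \<le> \<sigma> * \<alpha> ?z" using \<alpha>_pos[OF nz] by (intro mult_right_mono) (auto simp: \<rho>_def)
    then show ?thesis using True by simp
  next
    case False
    have s0: "\<sigma> > 0" using constants(2) by simp
    have "\<sigma> * \<alpha> b \<le> \<sigma> * (\<sigma> * \<alpha> ?z)" using False s0 by (intro mult_left_mono) auto
    then have sb: "\<sigma> * \<alpha> b \<le> \<alpha> x" using exp1 by simp
    define d where "d = \<alpha> x - \<alpha> b"
    have "\<alpha> b \<le> \<alpha> x / \<sigma>" using sb s0 by (simp add: field_simps)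
    then have d: "(1 - 1 / \<sigma>) * \<alpha> x \<le> d" by (simp add: d_def algebra_simps)
    have s1: "0 < 1 - 1 / \<sigma>" using constants(2) by simp
    have ax: "0 < \<alpha> x" using \<alpha>_pos nx by simp
    have bx: "\<alpha> b \<le> \<alpha> x" using d mult_pos_pos[OF s1 ax] by (simp add: d_def)
    have d1: "d \<le> K * (b - x)" "d \<le> K * (\<tau> x - \<tau> b)"
      using left_bounds(2)[OF nx, of b] right_bounds(2)[OF nx, of b] x bc by (auto simp: d_def)
    have "2 * K * \<alpha> b \<le> 2 * K * \<alpha> x" using bx K_pos by simp
    then have "\<tau> b - b \<le> 2 * K * \<alpha> x" using ilen_V_le[OF nb] ilen_V[of b] bc by linarith
    then have "(\<tau> b - b) * (\<tau> x - x) \<le> (2 * K * \<alpha> x) * (2 * K * \<alpha> x)"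
      using ilen_V_le[OF nx] ilen_V[OF xc] Nx ax K_pos by (intro mult_mono) auto
    then have "\<kappa>2 * ((\<tau> b - b) * (\<tau> x - x)) * K\<^sup>2 \<le> \<kappa>2 * ((2 * K * \<alpha> x) * (2 * K * \<alpha> x)) * K\<^sup>2"
      using constants(3) by (intro mult_left_mono mult_right_mono) auto
    also have "\<dots> = ((1 - 1 / \<sigma>) * \<alpha> x) * ((1 - 1 / \<sigma>) * \<alpha> x)"
      unfolding \<kappa>2_def using K_pos by (simp add: power2_eq_square power4_eq_xxxx)
    also have "\<dots> \<le> d * d" using d s1 ax bx by (intro mult_mono) (auto simp: d_def)
    also have "\<dots> \<le> (K * (b - x)) * (K * (\<tau> x - \<tau> b))"
      using d1 bx K_pos x by (intro mult_mono) (auto simp: d_def)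
    also have "\<dots> = (b - x) * (\<tau> x - \<tau> b) * K\<^sup>2" by (simp add: power2_eq_square)
    finally have le: "\<kappa>2 * ((\<tau> b - b) * (\<tau> x - x)) \<le> (b - x) * (\<tau> x - \<tau> b)"
      using K_pos by (simp add: mult_le_cancel_right)
    have "(f ^^ q') y \<in> {b..\<tau> b}" if "?z \<le> y" "y \<le> c" for y
      using R(3) R(4)[of y] that Vb Nb by (cases "y = ?z") auto
    then have "(1 + \<kappa>2) * (f c - f ?z) \<le> f c - f b"
      using koebe_space[OF q'(2) _ bc(1) R(1,2) xc, of b "\<tau> b" \<kappa>2] q0 q'(3) x tt constants(3) le by auto
    from \<alpha>_expand[OF nb nz constants(3) this] have "(1 + \<kappa>2) powr (1 / l) * \<alpha> ?z \<le> \<alpha> b" .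
    moreover have "\<rho> * \<alpha> ?z \<le> (1 + \<kappa>2) powr (1 / l) * \<alpha> ?z"
      using \<alpha>_pos[OF nz] by (intro mult_right_mono) (auto simp: \<rho>_def)
    ultimately show ?thesis by simp
  qed
  then show ?thesis
    by (rule transfer_range_of_expansion[OF b nb q'(1) constants(4)])
       (use constants K_pos in \<open>auto simp: \<delta>_def\<close>)
qed

end

section \<open>The nest of nice intervals\<close>

context recurrent_unimodal begin

lemma nest_step:
  assumes x: "lnice x" and q: "first_return q x" "2 \<le> q" and nr: "\<not> renormalizable_period f c q"
  obtains b q' where "lnice b" "x < b" "first_return q' b" "q < q'" "extends_to x b q'"
    "(f ^^ q) c \<notin> V b" "\<And>y. y \<in> V b \<Longrightarrow> (f ^^ q) y \<in> V x" "(f ^^ q) b \<in> {x..\<tau> x}"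
proof -
  define P where "P j \<longleftrightarrow> (f ^^ q) c \<notin> V (cascade q x j)" for j
  have "\<exists>j. P j"
    using infinite_cascade_renormalizable[OF x q crit_orbit_ne] nr q by (auto simp: P_def)
  then have L: "P (LEAST j. P j)" "\<And>i. i < (LEAST j. P j) \<Longrightarrow> \<not> P i"
    using not_less_Least by (metis LeastI)+
  have "\<not> P 0" using first_returnD(2)[OF q(1)] by (simp add: P_def cascade_simps)
  then have "(LEAST j. P j) \<noteq> 0" using L(1) by metis
  then obtain k where k: "(LEAST j. P j) = Suc k" using not0_implies_Suc by blast
  define b where "b = cascade q x (Suc k)"
  have cen: "(f ^^ q) c \<in> V (cascade q x i)" if "i \<le> k" for i
    using L(2)[of i] that k by (auto simp: P_def)
  have out: "(f ^^ q) c \<notin> V b" using L(1) k by (simp add: P_def b_def)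
  have "lnice b" unfolding b_def by (rule cascade_Suc_nice[OF x q(1) cen])
  then obtain q' where q': "first_return q' b" using first_return_exists lniceD by metis
  note facts = x q(1) cen b_def out q'
  show ?thesis
    by (rule that[OF b_nice[OF facts] x_less_b[OF facts] q' return_increases[OF facts]
          branch_extends[OF facts] out first_return_on_b[OF facts] first_return_of_b[OF facts]])
qed

text \<open>A relation on pairs, so that dependent choice picks an interval and its return time
  together.\<close>

definition nest_relation :: "real \<times> nat \<Rightarrow> real \<times> nat \<Rightarrow> bool" where
  "nest_relation = (\<lambda>(x, q) (b, q'). x < b \<and> q < q' \<and> extends_to x b q' \<and> (f ^^ q) c \<notin> V b \<and>
     (\<forall>y \<in> V b. (f ^^ q) y \<in> V x) \<and> (f ^^ q) b \<in> {x..\<tau> x})"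

lemma nest_exists:
  assumes fin: "finitely_renormalizable f c" and e: "e < c"
  obtains X :: "nat \<Rightarrow> real" and Q :: "nat \<Rightarrow> nat"
  where "e < X 0" "\<And>n. lnice (X n)" "\<And>n. first_return (Q n) (X n)"
    "\<And>n. nest_relation (X n, Q n) (X (Suc n), Q (Suc n))"
proof -
  obtain M where M: "\<And>n. renormalizable_period f c n \<Longrightarrow> n \<le> M"
    using fin unfolding finitely_renormalizable_def by (metis finite_nat_set_iff_bounded_le mem_Collect_eq)
  \<comment> \<open>The maximum with 1 makes every time above \<open>N\<close> at least 2, as a
    renormalization period has to be.\<close>
  define N where "N = max M 1"
  define F where "F = (\<lambda>j. f ((f ^^ j) c)) ` {1..N}"
  have low: "f ((f ^^ j) c) < f c" if "0 < j" for j
    using crit_orbit_ne[OF that] incr[of "(f ^^ j) c" c] decr[of c "(f ^^ j) c"] iter_range[of c j] c01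
    by (cases "(f ^^ j) c < c") auto
  \<comment> \<open>A nice interval whose endpoint is higher than \<open>m\<close> misses the first
    \<open>N\<close> points of the critical orbit, so its first return time exceeds
    \<open>N\<close>.\<close>
  define m where "m = Max (insert 0 F)"
  have "0 < f c" using incr[of 0 c] f0 c01 by simp
  then have m: "m < f c" "0 \<le> m" using low by (auto simp: m_def F_def)
  obtain x1 where x1: "0 \<le> x1" "x1 \<le> c" "f x1 = m"
    using IVT'[of f 0 m c] m f0 c01 continuous_on_subset[OF cont_f, of "{0..c}"] by auto
  have "x1 < c" using x1 m by (cases "x1 = c") auto
  then obtain x where x: "lnice x" "max e x1 < x" using nice_points_accumulate[of "max e x1"] e by auto
  have xc: "0 \<le> x" "x < c" using x lniceD by auto
  obtain q where q: "first_return q x" using first_return_exists xc by metis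
  have "N < q"
  proof (rule ccontr)
    assume "\<not> ?thesis"
    then have "f ((f ^^ q) c) \<in> insert 0 F" using first_returnD(1)[OF q] by (auto simp: F_def)
    then have "f ((f ^^ q) c) \<le> m" unfolding m_def F_def by (intro Max_ge) auto
    also have "m < f x" using incr[of x1 x] x1 x xc by simp
    finally show False using first_returnD(2)[OF q] V_iff[OF xc, of "(f ^^ q) c"] iter_range[of c q] c01 by auto
  qed
  define P where "P = (\<lambda>n::nat. \<lambda>(x, q). lnice x \<and> first_return q x \<and> N < q \<and> (n = 0 \<longrightarrow> e < x))"
  have "\<exists>Z. \<forall>n. P n (Z n) \<and> nest_relation (Z n) (Z (Suc n))"
  proof (rule dependent_nat_choice)
    show "\<exists>z. P 0 z" using x q \<open>N < q\<close> by (auto simp: P_def)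
  next
    fix z n assume "P n z"
    then obtain y p where z: "z = (y, p)" "lnice y" "first_return p y" "N < p" by (auto simp: P_def)
    have "2 \<le> p" "\<not> renormalizable_period f c p" using z(4) M[of p] by (auto simp: N_def)
    then obtain b q' where "lnice b" "y < b" "first_return q' b" "p < q'" "extends_to y b q'"
      "(f ^^ p) c \<notin> V b" "\<And>t. t \<in> V b \<Longrightarrow> (f ^^ p) t \<in> V y" "(f ^^ p) b \<in> {y..\<tau> y}"
      using nest_step[OF z(2,3)] by metis
    then have "P (Suc n) (b, q') \<and> nest_relation z (b, q')"
      using z by (auto simp: P_def nest_relation_def)
    then show "\<exists>z'. P (Suc n) z' \<and> nest_relation z z'" by blast
  qed
  then obtain Z where Z: "\<And>n. P n (Z n)" "\<And>n. nest_relation (Z n) (Z (Suc n))" by blast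
  show ?thesis
    by (rule that[of "fst \<circ> Z" "snd \<circ> Z"])
       (use Z(1)[of 0] Z in \<open>auto simp: P_def case_prod_beta\<close>)
qed

text \<open>If the limit \<open>a\<close> were below \<open>c\<close>, the return time of
  \<open>c\<close> to \<open>V a\<close>, which lies in every \<open>V (X n)\<close>, would bound
  all the \<open>Q n\<close>.\<close>

lemma nest_shrinks:
  assumes X: "\<And>n. lnice (X n)" and Q: "\<And>n. first_return (Q n) (X n)"
    and X_mono: "\<And>n. X n < X (Suc n)" and Q_mono: "\<And>n. Q n < Q (Suc n)"
  shows "X \<longlonglongrightarrow> c"
proof -
  have X01: "0 \<le> X n" "X n < c" for n using X lniceD by auto
  have "incseq X" using X_mono by (intro incseq_SucI less_imp_le)
  then obtain a where a: "X \<longlonglongrightarrow> a" "\<And>n. X n \<le> a"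
    using incseq_convergent[of X c] X01 less_imp_le by metis
  have "a \<le> c" by (rule LIMSEQ_le_const2[OF a(1)]) (use X01 less_imp_le in blast)
  moreover have "\<not> a < c"
  proof
    assume ac: "a < c"
    have a0: "0 \<le> a" using X01(1)[of 0] a(2)[of 0] by simp
    obtain m where m: "first_return m a" using first_return_exists[OF a0 ac] .
    have le: "Q n \<le> m" for n
    proof (rule ccontr)
      assume "\<not> ?thesis"
      then have "(f ^^ m) c \<notin> V (X n)" using first_returnD(3)[OF Q, of m n] first_returnD(1)[OF m] by simp
      then show False using first_returnD(2)[OF m] V_mono[OF X01(1) a(2) ac] by blast
    qed
    have "strict_mono Q" using Q_mono by (rule strict_monoI_Suc)
    then have "Suc m \<le> Q (Suc m)" by (rule strict_mono_imp_increasing)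
    then show False using le[of "Suc m"] by simp
  qed
  ultimately show ?thesis using a(1) by simp
qed

end

lemma positive_null_sequence_descends:
  fixes d :: "nat \<Rightarrow> real"
  assumes lim: "d \<longlonglongrightarrow> 0" and pos: "\<And>n. 0 < d n"
  shows "\<exists>n\<ge>N. d (Suc n) \<le> d n"
proof (rule ccontr)
  assume "\<not> ?thesis"
  then have up: "\<And>n. N \<le> n \<Longrightarrow> d n < d (Suc n)" by (meson not_le)
  have "d N \<le> d n" if "N \<le> n" for n
    using that
  proof (induction n rule: dec_induct)
    case (step n)
    then show ?case using up[of n] by simp
  qed simp
  then have "d N \<le> 0" by (intro LIMSEQ_le_const[OF lim]) blast
  then show False using pos[of N] by simp
qed

lemma (in critical_coordinate) transfer_ranges_exist:
  assumes fin: "finitely_renormalizable f c"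
  shows "\<exists>y. (\<forall>n. transfer_range f c \<delta> (y n)) \<and> (\<lambda>n. ilen (V (y n))) \<longlonglongrightarrow> 0"
proof -
  have "f (c + e) < f c" using decr[of c "c + e"] e c01 by simp
  moreover have "f 0 \<le> f (c + e)" using range[of "c + e"] f0 e c01 by simp
  \<comment> \<open>The mirror image of \<open>c + e\<close>: starting beyond it keeps the right
    endpoints inside the coordinate neighbourhood.\<close>
  ultimately obtain x0 where x0: "0 \<le> x0" "x0 \<le> c" "f x0 = f (c + e)"
    using IVT'[of f 0 "f (c + e)" c] c01 continuous_on_subset[OF cont_f, of "{0..c}"] by auto
  have "x0 < c" using x0 \<open>f (c + e) < f c\<close> by (cases "x0 = c") auto
  then have tx0: "\<tau> x0 = c + e" using tau_unique[of x0 "c + e"] x0 e c01 by auto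
  obtain X Q where X0: "max (c - e) x0 < X 0" and X: "\<And>n. lnice (X n)"
    and Q: "\<And>n. first_return (Q n) (X n)"
    and R: "\<And>n. nest_relation (X n, Q n) (X (Suc n), Q (Suc n))"
    using nest_exists[OF fin, of "max (c - e) x0"] \<open>x0 < c\<close> e by auto
  have R': "X n < X (Suc n)" "Q n < Q (Suc n)" "extends_to (X n) (X (Suc n)) (Q (Suc n))"
    "(f ^^ Q n) c \<notin> V (X (Suc n))" "\<And>y. y \<in> V (X (Suc n)) \<Longrightarrow> (f ^^ Q n) y \<in> V (X n)"
    "(f ^^ Q n) (X (Suc n)) \<in> {X n..\<tau> (X n)}" for n
    using R[of n] unfolding nest_relation_def by auto
  have X01: "0 \<le> X n" "X n < c" for n using X lniceD by auto
  have Xlim: "X \<longlonglongrightarrow> c" by (rule nest_shrinks[of X Q]) (rule X Q R')+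
  have "incseq X" using R'(1) by (intro incseq_SucI less_imp_le)
  then have XX: "X m \<le> X n" if "m \<le> n" for m n using that by (rule incseqD)
  have near0: "near (X 0)"
    using X0 X01 tau_strict[of x0 "X 0"] x0 tx0 by (auto simp: near_def)
  then have near: "near (X n)" for n using near_mono XX X01 by blast
  define d where "d n = \<alpha> (X n) - \<alpha> (X (Suc n))" for n
  have Klim: "(\<lambda>n. K * (c - X n)) \<longlonglongrightarrow> 0"
    using tendsto_mult_left[OF tendsto_diff[OF tendsto_const[of c] Xlim], of K] by simp
  have \<alpha>lim: "(\<lambda>n. \<alpha> (X n)) \<longlonglongrightarrow> 0"
    by (rule tendsto_sandwich[OF _ _ tendsto_const Klim])
       (use center_bounds(2)[OF near] \<alpha>_pos[OF near] in \<open>auto intro!: always_eventually less_imp_le\<close>)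
  then have dlim: "d \<longlonglongrightarrow> 0"
    unfolding d_def using tendsto_diff[OF \<alpha>lim LIMSEQ_Suc[OF \<alpha>lim]] by simp
  have dpos: "0 < d n" for n
  proof -
    have "0 < K * d n" using left_bounds(1)[OF near, of n "X (Suc n)"] R'(1)[of n] X01 by (simp add: d_def)
    then show ?thesis using K_pos by (simp add: zero_less_mult_iff)
  qed
  have "\<forall>N. \<exists>n\<ge>N. d (Suc n) \<le> d n" using positive_null_sequence_descends[OF dlim dpos] by blast
  \<comment> \<open>Monotonicity of \<open>\<nu>\<close> plays no part in the limit:
    \<open>N \<le> \<nu> N\<close> alone bounds the lengths by a null sequence.\<close>
  then obtain \<nu> where \<nu>: "\<And>N. N \<le> \<nu> N" "\<And>N. d (Suc (\<nu> N)) \<le> d (\<nu> N)" by metis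
  define y where "y N = X (Suc (Suc (\<nu> N)))" for N
  have "transfer_range f c \<delta> (y N)" for N
    unfolding y_def
    by (rule transfer_range_step[of "X (\<nu> N)" "X (Suc (\<nu> N))" _ "Q (Suc (\<nu> N))" "Q (Suc (Suc (\<nu> N)))"])
       (use near X Q R' \<nu>(2)[of N] in \<open>simp_all add: d_def\<close>)
  moreover have "(\<lambda>n. ilen (V (y n))) \<longlonglongrightarrow> 0"
  proof (rule tendsto_sandwich[OF _ _ tendsto_const])
    show "(\<lambda>n. 2 * K * (K * (c - X n))) \<longlonglongrightarrow> 0" using tendsto_mult_left[OF Klim, of "2 * K"] by simp
    have "0 \<le> ilen (V (y n))" for n
      using ilen_V[OF X01] tau_left(1)[OF X01] X01 by (simp add: y_def) (meson less_imp_le less_trans)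
    then show "\<forall>\<^sub>F n in sequentially. 0 \<le> ilen (V (y n))" by simp
    have "ilen (V (y n)) \<le> 2 * K * (K * (c - X n))" for n
    proof -
      have "ilen (V (y n)) \<le> 2 * K * \<alpha> (y n)" using ilen_V_le near by (simp add: y_def)
      also have "\<dots> \<le> 2 * K * (K * (c - y n))"
        using center_bounds(2)[OF near] K_pos by (simp add: y_def)
      also have "\<dots> \<le> 2 * K * (K * (c - X n))"
        using XX[of n "Suc (Suc (\<nu> n))"] \<nu>(1)[of n] K_pos by (simp add: y_def)
      finally show ?thesis .
    qed
    then show "\<forall>\<^sub>F n in sequentially. ilen (V (y n)) \<le> 2 * K * (K * (c - X n))" by simp
  qed
  ultimately show ?thesis by blast
qed

theorem theorem3p4:
  fixes f :: "real \<Rightarrow> real" and c :: real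
  assumes "S_unimodal f c"
    and "finitely_renormalizable f c"
    and "recurrent_pt f c"
    and "\<not> periodic_pt f c"
  shows "\<exists>\<delta>>0. \<exists>y :: nat \<Rightarrow> real.
           (\<forall>n. y n \<in> nice_points f c \<and> transfer_range f c \<delta> (y n)) \<and>
           (\<lambda>n. ilen (Vint f c (y n))) \<longlonglongrightarrow> 0"
proof -
  interpret recurrent_unimodal f c by unfold_locales (rule assms)+
  obtain l K e \<alpha> where "critical_coordinate f c l K e \<alpha>" using critical_coordinate_exists by blast
  then interpret critical_coordinate f c l K e \<alpha> .
  show ?thesis using transfer_ranges_exist[OF assms(2)] constants(5)
    unfolding transfer_range_def by blast
qed

end
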